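(* Let $(M^{2m},J,g)$ be a standard Kähler locally symmetric manifold with curvature tensor $R$, let $(T^{*}M,{}^{BS}g)$ be its cotangent bundle equipped with the Berger-type deformed Sasaki metric with constant $\delta$, and let $C=(\gamma(t),\vartheta(t))$ be a geodesic on $(T^{*}M,{}^{BS}g)$. Then the field of endomorphisms $$\mathcal{R}(\widetilde{\vartheta'},\widetilde{\vartheta})=R(\widetilde{\vartheta'},\widetilde{\vartheta})+\delta^{2}g^{-1}(\vartheta',\vartheta J)\,R(\widetilde{\vartheta},J\widetilde{\vartheta})$$ is parallel along the projected curve $\gamma=\pi\circ C$.
   Context: All objects are smooth. A standard Kähler manifold $(M^{2m},J,g)$ is a $2m$-dimensional manifold with an almost complex structure $J$ ($J^2=-I$) and a Riemannian metric $g$ with $g(JX,JY)=g(X,Y)$ such that $\nabla J=0$, where $\nabla$ is the Levi-Civita connection of $g$. Locally symmetric means $\nabla R=0$. The curvature convention is $R(X,Y)Z=\nabla_X\nabla_YZ-\nabla_Y\nabla_XZ-\nabla_{[X,Y]}Z$. $\pi:T^{*}M\to M$ is the projection. For a covector $\omega$, $\widetilde\omega$ is the vector with $g(\widetilde\omega,X)=\omega(X)$ for all $X$; $g^{-1}(\omega,\theta)=g(\widetilde\omega,\widetilde\theta)$; $\omega J$ is the covector $(\omega J)(X)=\omega(JX)$. In the coordinates $(x^i,p_i)$ on $T^{*}M$ induced by coordinates $(x^i)$ on $M$, with Christoffel symbols $\Gamma^k_{ij}$ of $g$, the horizontal lift of $X=X^i\partial_{x^i}$ is ${}^{H}X=X^{i}\partial_{x^i}+p_{h}\Gamma^{h}_{ij}X^{j}\partial_{p_i}$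 and the vertical lift of $\omega=\omega_idx^i$ is ${}^{V}\omega=\omega_i\partial_{p_i}$. The Berger-type deformed Sasaki metric ${}^{BS}g$ on $T^{*}M$, with real constant $\delta$, is the Riemannian metric defined at $(x,p)$ by ${}^{BS}g({}^{H}X,{}^{H}Y)=g(X,Y)$, ${}^{BS}g({}^{H}X,{}^{V}\theta)=0$, ${}^{BS}g({}^{V}\omega,{}^{V}\theta)=g^{-1}(\omega,\theta)+\delta^{2}g^{-1}(\omega,pJ)\,g^{-1}(\theta,pJ)$. A curve $C=(\gamma(t),\vartheta(t))$ on $T^{*}M$ consists of a curve $\gamma$ on $M$ and a covector field $\vartheta$ along $\gamma$; $\vartheta'=\nabla_{\gamma'}\vartheta$ is the covariant derivative along $\gamma$. *)

theory Defs
  imports "HOL-Analysis.Analysis"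
begin

text \<open>
  Conventions.  A chart is a pair of a domain and a coordinate map into the model space
  \<open>'e\<close>.  A tensor field is given by its component functions in every chart of the atlas,
  subject to the transformation law under changes of coordinates.  Indices range over
  \<open>Basis\<close>: a tangent vector \<open>X\<^sup>i \<partial>\<^sub>i\<close> has the component vector \<open>\<Sum>i\<in>Basis. X\<^sup>i *\<^sub>R i\<close>, a covector
  \<open>\<omega>\<^sub>i dx\<^sup>i\<close> has the component vector \<open>\<Sum>i\<in>Basis. \<omega>\<^sub>i *\<^sub>R i\<close>, and \<open>\<omega> \<bullet> X\<close> is the pairing
  \<open>\<omega>\<^sub>i X\<^sup>i\<close>; the inner product of \<open>'e\<close> has no other role.
\<close>

section \<open>Smooth maps and manifolds\<close>

fun Ck_on :: "nat \<Rightarrow> 'b set \<Rightarrow> ('b::euclidean_space \<Rightarrow> 'c::real_normed_vector) \<Rightarrow> bool" where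
  "Ck_on 0 S f \<longleftrightarrow> continuous_on S f"
| "Ck_on (Suc k) S f \<longleftrightarrow>
     (\<forall>x\<in>S. f differentiable (at x)) \<and> (\<forall>v. Ck_on k S (\<lambda>x. frechet_derivative f (at x) v))"

text \<open>Only used for open sets \<open>S\<close>.\<close>

definition smooth_on :: "'b set \<Rightarrow> ('b::euclidean_space \<Rightarrow> 'c::real_normed_vector) \<Rightarrow> bool" where
  "smooth_on S f \<longleftrightarrow> (\<forall>k. Ck_on k S f)"

type_synonym ('a, 'e) chart = "'a set \<times> ('a \<Rightarrow> 'e)"

abbreviation chart_dom :: "('a, 'e) chart \<Rightarrow> 'a set" where "chart_dom c \<equiv> fst c"
abbreviation chart_map :: "('a, 'e) chart \<Rightarrow> 'a \<Rightarrow> 'e" where "chart_map c \<equiv> snd c"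

definition chart_img :: "('a, 'e) chart \<Rightarrow> 'e set" where
  "chart_img c = chart_map c ` chart_dom c"

definition transition :: "('a, 'e) chart \<Rightarrow> ('a, 'e) chart \<Rightarrow> 'e \<Rightarrow> 'e" where
  "transition c d = chart_map d \<circ> inv_into (chart_dom c) (chart_map c)"

definition jac :: "('a, 'e::euclidean_space) chart \<Rightarrow> ('a, 'e) chart \<Rightarrow> 'a \<Rightarrow> 'e \<Rightarrow> 'e" where
  "jac c d x = frechet_derivative (transition c d) (at (chart_map c x))"

definition smooth_manifold :: "'a topology \<Rightarrow> ('a, 'e::euclidean_space) chart set \<Rightarrow> bool" where
  "smooth_manifold X A \<longleftrightarrow>
     Hausdorff_space X \<and> second_countable X \<and>
     topspace X = (\<Union>c\<in>A. chart_dom c) \<and>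
     (\<forall>c\<in>A. openin X (chart_dom c) \<and> open (chart_img c) \<and>
        homeomorphic_map (subtopology X (chart_dom c)) (top_of_set (chart_img c)) (chart_map c)) \<and>
     (\<forall>c\<in>A. \<forall>d\<in>A. smooth_on (chart_map c ` (chart_dom c \<inter> chart_dom d)) (transition c d))"

section \<open>Riemannian geometry in a coordinate domain\<close>

text \<open>The vector \<open>\<Gamma>\<^sup>k\<^sub>i\<^sub>j u\<^sup>i v\<^sup>j \<partial>\<^sub>k\<close>, where
  \<open>g\<^sub>k\<^sub>l \<Gamma>\<^sup>k\<^sub>i\<^sub>j = (\<partial>\<^sub>i g\<^sub>j\<^sub>l + \<partial>\<^sub>j g\<^sub>i\<^sub>l - \<partial>\<^sub>l g\<^sub>i\<^sub>j) / 2\<close>.\<close>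

definition christoffel ::
  "('e::euclidean_space \<Rightarrow> 'e \<Rightarrow> 'e \<Rightarrow> real) \<Rightarrow> 'e \<Rightarrow> 'e \<Rightarrow> 'e \<Rightarrow> 'e" where
  "christoffel G y u v = (THE z. \<forall>w. G y z w =
     (frechet_derivative (\<lambda>y. G y v w) (at y) u
      + frechet_derivative (\<lambda>y. G y u w) (at y) v
      - frechet_derivative (\<lambda>y. G y u v) (at y) w) / 2)"

definition nabla ::
  "('e::euclidean_space \<Rightarrow> 'e \<Rightarrow> 'e \<Rightarrow> real) \<Rightarrow> ('e \<Rightarrow> 'e) \<Rightarrow> ('e \<Rightarrow> 'e) \<Rightarrow> 'e \<Rightarrow> 'e" where
  "nabla G X Y y = frechet_derivative Y (at y) (X y) + christoffel G y (X y) (Y y)"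

definition lie_bracket :: "('e::euclidean_space \<Rightarrow> 'e) \<Rightarrow> ('e \<Rightarrow> 'e) \<Rightarrow> 'e \<Rightarrow> 'e" where
  "lie_bracket X Y y = frechet_derivative Y (at y) (X y) - frechet_derivative X (at y) (Y y)"

text \<open>The tensor is evaluated by extending the three vectors to fields with constant
  components.\<close>

definition curvature ::
  "('e::euclidean_space \<Rightarrow> 'e \<Rightarrow> 'e \<Rightarrow> real) \<Rightarrow> 'e \<Rightarrow> 'e \<Rightarrow> 'e \<Rightarrow> 'e \<Rightarrow> 'e" where
  "curvature G y u v w =
     (let X = (\<lambda>_. u); Y = (\<lambda>_. v); Z = (\<lambda>_. w) in
      nabla G X (nabla G Y Z) y - nabla G Y (nabla G X Z) y - nabla G (lie_bracket X Y) Z y)"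

definition nabla_endo ::
  "('e::euclidean_space \<Rightarrow> 'e \<Rightarrow> 'e \<Rightarrow> real) \<Rightarrow> ('e \<Rightarrow> 'e \<Rightarrow> 'e) \<Rightarrow> 'e \<Rightarrow> 'e \<Rightarrow> 'e \<Rightarrow> 'e" where
  "nabla_endo G E y z u =
     nabla G (\<lambda>_. z) (\<lambda>y. E y u) y - E y (nabla G (\<lambda>_. z) (\<lambda>_. u) y)"

definition nabla_curvature ::
  "('e::euclidean_space \<Rightarrow> 'e \<Rightarrow> 'e \<Rightarrow> real) \<Rightarrow> 'e \<Rightarrow> 'e \<Rightarrow> 'e \<Rightarrow> 'e \<Rightarrow> 'e \<Rightarrow> 'e" where
  "nabla_curvature G y z u v w =
     (let D = (\<lambda>a. nabla G (\<lambda>_. z) (\<lambda>_. a) y) in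
      nabla G (\<lambda>_. z) (\<lambda>y. curvature G y u v w) y
      - curvature G y (D u) v w - curvature G y u (D v) w - curvature G y u v (D w))"

text \<open>The vector dual to a covector, and the induced inner product on covectors.\<close>

definition sharp :: "('e::euclidean_space \<Rightarrow> 'e \<Rightarrow> 'e \<Rightarrow> real) \<Rightarrow> 'e \<Rightarrow> 'e \<Rightarrow> 'e" where
  "sharp G y \<omega> = (THE v. \<forall>u. G y v u = \<omega> \<bullet> u)"

definition ginv :: "('e::euclidean_space \<Rightarrow> 'e \<Rightarrow> 'e \<Rightarrow> real) \<Rightarrow> 'e \<Rightarrow> 'e \<Rightarrow> 'e \<Rightarrow> real" where
  "ginv G y \<omega> \<theta> = G y (sharp G y \<omega>) (sharp G y \<theta>)"

text \<open>The covector \<open>X \<mapsto> \<omega> (J X)\<close>.\<close>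

definition covec_comp :: "'e::euclidean_space \<Rightarrow> ('e \<Rightarrow> 'e) \<Rightarrow> 'e" where
  "covec_comp \<omega> J = (\<Sum>i\<in>Basis. (\<omega> \<bullet> J i) *\<^sub>R i)"

section \<open>Tensor fields on a manifold\<close>

definition riemannian_metric ::
  "('a, 'e::euclidean_space) chart set \<Rightarrow> (('a, 'e) chart \<Rightarrow> 'e \<Rightarrow> 'e \<Rightarrow> 'e \<Rightarrow> real) \<Rightarrow> bool" where
  "riemannian_metric A g \<longleftrightarrow>
     (\<forall>c\<in>A. \<forall>y\<in>chart_img c. bilinear (g c y) \<and>
        (\<forall>u v. g c y u v = g c y v u) \<and> (\<forall>u. u \<noteq> 0 \<longrightarrow> g c y u u > 0)) \<and>
     (\<forall>c\<in>A. \<forall>u v. smooth_on (chart_img c) (\<lambda>y. g c y u v)) \<and>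
     (\<forall>c\<in>A. \<forall>d\<in>A. \<forall>x\<in>chart_dom c \<inter> chart_dom d. \<forall>u v.
        g c (chart_map c x) u v = g d (chart_map d x) (jac c d x u) (jac c d x v))"

definition almost_complex_structure ::
  "('a, 'e::euclidean_space) chart set \<Rightarrow> (('a, 'e) chart \<Rightarrow> 'e \<Rightarrow> 'e \<Rightarrow> 'e) \<Rightarrow> bool" where
  "almost_complex_structure A J \<longleftrightarrow>
     (\<forall>c\<in>A. \<forall>y\<in>chart_img c. linear (J c y) \<and> (\<forall>u. J c y (J c y u) = - u)) \<and>
     (\<forall>c\<in>A. \<forall>u. smooth_on (chart_img c) (\<lambda>y. J c y u)) \<and>
     (\<forall>c\<in>A. \<forall>d\<in>A. \<forall>x\<in>chart_dom c \<inter> chart_dom d. \<forall>u.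
        jac c d x (J c (chart_map c x) u) = J d (chart_map d x) (jac c d x u))"

definition kaehler_structure ::
  "('a, 'e::euclidean_space) chart set \<Rightarrow> (('a, 'e) chart \<Rightarrow> 'e \<Rightarrow> 'e \<Rightarrow> 'e) \<Rightarrow>
   (('a, 'e) chart \<Rightarrow> 'e \<Rightarrow> 'e \<Rightarrow> 'e \<Rightarrow> real) \<Rightarrow> bool" where
  "kaehler_structure A J g \<longleftrightarrow>
     almost_complex_structure A J \<and> riemannian_metric A g \<and>
     (\<forall>c\<in>A. \<forall>y\<in>chart_img c.
        (\<forall>u v. g c y (J c y u) (J c y v) = g c y u v) \<and>
        (\<forall>z u. nabla_endo (g c) (J c) y z u = 0))"

definition locally_symmetric ::
  "('a, 'e::euclidean_space) chart set \<Rightarrow> (('a, 'e) chart \<Rightarrow> 'e \<Rightarrow> 'e \<Rightarrow> 'e \<Rightarrow> real) \<Rightarrow> bool" where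
  "locally_symmetric A g \<longleftrightarrow>
     (\<forall>c\<in>A. \<forall>y\<in>chart_img c. \<forall>z u v w. nabla_curvature (g c) y z u v w = 0)"

section \<open>The cotangent bundle\<close>

text \<open>A covector at \<open>x\<close> is a compatible family of components, one for every chart around \<open>x\<close>;
  it is set to zero elsewhere so that it is determined by these components.\<close>

definition cotangent_space ::
  "('a, 'e::euclidean_space) chart set \<Rightarrow> 'a \<Rightarrow> (('a, 'e) chart \<Rightarrow> 'e) set" where
  "cotangent_space A x = {p.
     (\<forall>c\<in>A. \<forall>d\<in>A. x \<in> chart_dom c \<inter> chart_dom d \<longrightarrow> (\<forall>u. p c \<bullet> u = p d \<bullet> jac c d x u)) \<and>
     (\<forall>c. \<not> (c \<in> A \<and> x \<in> chart_dom c) \<longrightarrow> p c = 0)}"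

text \<open>The coordinates \<open>(x\<^sup>i, p\<^sub>i)\<close> induced by the coordinates \<open>x\<^sup>i\<close>.\<close>

definition cotangent_chart ::
  "('a, 'e::euclidean_space) chart set \<Rightarrow> ('a, 'e) chart \<Rightarrow>
   ('a \<times> (('a, 'e) chart \<Rightarrow> 'e), 'e \<times> 'e) chart" where
  "cotangent_chart A c =
     ({(x, p). x \<in> chart_dom c \<and> p \<in> cotangent_space A x}, \<lambda>(x, p). (chart_map c x, p c))"

definition cotangent_atlas ::
  "('a, 'e::euclidean_space) chart set \<Rightarrow>
   ('a \<times> (('a, 'e) chart \<Rightarrow> 'e), 'e \<times> 'e) chart set" where
  "cotangent_atlas A = cotangent_chart A ` A"

text \<open>Components at \<open>(y, p)\<close>, in the induced coordinates, of the horizontal lift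
  \<open>X\<^sup>i \<partial>\<^sub>x\<^sub>i + p\<^sub>h \<Gamma>\<^sup>h\<^sub>i\<^sub>j X\<^sup>j \<partial>\<^sub>p\<^sub>i\<close> and of the vertical lift \<open>\<omega>\<^sub>i \<partial>\<^sub>p\<^sub>i\<close>.\<close>

definition horizontal_lift ::
  "('e::euclidean_space \<Rightarrow> 'e \<Rightarrow> 'e \<Rightarrow> real) \<Rightarrow> 'e \<Rightarrow> 'e \<Rightarrow> 'e \<Rightarrow> 'e \<times> 'e" where
  "horizontal_lift G y p X = (X, \<Sum>i\<in>Basis. (p \<bullet> christoffel G y i X) *\<^sub>R i)"

definition vertical_lift :: "'e::euclidean_space \<Rightarrow> 'e \<times> 'e" where
  "vertical_lift \<omega> = (0, \<omega>)"

text \<open>The horizontal and vertical lifts span the tangent spaces of the cotangent bundle, so this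
  determines \<open>h\<close> in the induced charts.\<close>

definition berger_sasaki_metric ::
  "('a, 'e::euclidean_space) chart set \<Rightarrow> (('a, 'e) chart \<Rightarrow> 'e \<Rightarrow> 'e \<Rightarrow> 'e) \<Rightarrow>
   (('a, 'e) chart \<Rightarrow> 'e \<Rightarrow> 'e \<Rightarrow> 'e \<Rightarrow> real) \<Rightarrow> real \<Rightarrow>
   (('a \<times> (('a, 'e) chart \<Rightarrow> 'e), 'e \<times> 'e) chart \<Rightarrow>
      'e \<times> 'e \<Rightarrow> 'e \<times> 'e \<Rightarrow> 'e \<times> 'e \<Rightarrow> real) \<Rightarrow> bool" where
  "berger_sasaki_metric A J g \<delta> h \<longleftrightarrow>
     riemannian_metric (cotangent_atlas A) h \<and>
     (\<forall>c\<in>A. \<forall>y\<in>chart_img c. \<forall>p.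
        let H = horizontal_lift (g c) y p; V = vertical_lift;
            b = h (cotangent_chart A c) (y, p); gi = ginv (g c) y; pJ = covec_comp p (J c y)
        in (\<forall>X Y. b (H X) (H Y) = g c y X Y) \<and>
           (\<forall>X \<theta>. b (H X) (V \<theta>) = 0) \<and>
           (\<forall>\<omega> \<theta>. b (V \<omega>) (V \<theta>) = gi \<omega> \<theta> + \<delta>\<^sup>2 * gi \<omega> pJ * gi \<theta> pJ))"

section \<open>Curves\<close>

definition smooth_curve ::
  "('a, 'e::euclidean_space) chart set \<Rightarrow> real set \<Rightarrow> (real \<Rightarrow> 'a) \<Rightarrow> bool" where
  "smooth_curve A I \<gamma> \<longleftrightarrow>
     (\<forall>t\<in>I. \<gamma> t \<in> (\<Union>c\<in>A. chart_dom c)) \<and>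
     (\<forall>c\<in>A. \<forall>t\<in>I. \<gamma> t \<in> chart_dom c \<longrightarrow>
        (\<exists>T. open T \<and> t \<in> T \<and> T \<subseteq> I \<and> \<gamma> ` T \<subseteq> chart_dom c \<and> smooth_on T (chart_map c \<circ> \<gamma>)))"

text \<open>The velocity of a curve, in the components of the chart \<open>c\<close>.\<close>

definition velocity :: "('a, 'e::euclidean_space) chart \<Rightarrow> (real \<Rightarrow> 'a) \<Rightarrow> real \<Rightarrow> 'e" where
  "velocity c \<gamma> t = vector_derivative (chart_map c \<circ> \<gamma>) (at t)"

definition geodesic ::
  "('a, 'e::euclidean_space) chart set \<Rightarrow> (('a, 'e) chart \<Rightarrow> 'e \<Rightarrow> 'e \<Rightarrow> 'e \<Rightarrow> real) \<Rightarrow>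
   real set \<Rightarrow> (real \<Rightarrow> 'a) \<Rightarrow> bool" where
  "geodesic A g I \<gamma> \<longleftrightarrow>
     smooth_curve A I \<gamma> \<and>
     (\<forall>c\<in>A. \<forall>t\<in>I. \<gamma> t \<in> chart_dom c \<longrightarrow>
        vector_derivative (velocity c \<gamma>) (at t)
        + christoffel (g c) (chart_map c (\<gamma> t)) (velocity c \<gamma> t) (velocity c \<gamma> t) = 0)"

text \<open>The covariant derivative along \<open>\<gamma>\<close> of a covector field \<open>\<theta>\<close>, with components
  \<open>d\<theta>\<^sub>i/dt - \<Gamma>\<^sup>h\<^sub>i\<^sub>j \<theta>\<^sub>h d\<gamma>\<^sup>j/dt\<close>.\<close>

definition covec_deriv ::
  "(('a, 'e::euclidean_space) chart \<Rightarrow> 'e \<Rightarrow> 'e \<Rightarrow> 'e \<Rightarrow> real) \<Rightarrow> (real \<Rightarrow> 'a) \<Rightarrow>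
   (real \<Rightarrow> ('a, 'e) chart \<Rightarrow> 'e) \<Rightarrow> real \<Rightarrow> ('a, 'e) chart \<Rightarrow> 'e" where
  "covec_deriv g \<gamma> \<theta> t c =
     vector_derivative (\<lambda>s. \<theta> s c) (at t)
     - (\<Sum>i\<in>Basis. (\<theta> t c \<bullet> christoffel (g c) (chart_map c (\<gamma> t)) i (velocity c \<gamma> t)) *\<^sub>R i)"

text \<open>The covariant derivative along \<open>\<gamma>\<close> of an endomorphism field \<open>E\<close> is
  \<open>dE/dt + [\<Gamma>(\<gamma>', _), E]\<close> in every chart; \<open>E\<close> is parallel if it exists and vanishes.\<close>

definition parallel_endo_along ::
  "('a, 'e::euclidean_space) chart set \<Rightarrow> (('a, 'e) chart \<Rightarrow> 'e \<Rightarrow> 'e \<Rightarrow> 'e \<Rightarrow> real) \<Rightarrow>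
   real set \<Rightarrow> (real \<Rightarrow> 'a) \<Rightarrow> (real \<Rightarrow> ('a, 'e) chart \<Rightarrow> 'e \<Rightarrow> 'e) \<Rightarrow> bool" where
  "parallel_endo_along A g I \<gamma> E \<longleftrightarrow>
     (\<forall>c\<in>A. \<forall>t\<in>I. \<gamma> t \<in> chart_dom c \<longrightarrow>
        (let \<Gamma> = christoffel (g c) (chart_map c (\<gamma> t)) (velocity c \<gamma> t) in
         \<forall>u. \<exists>E'. ((\<lambda>s. E s c u) has_vector_derivative E') (at t) \<and>
               E' + \<Gamma> (E t c u) - E t c (\<Gamma> u) = 0))"

text \<open>The endomorphism \<open>R(\<theta>'\<^sup>\<sharp>, \<theta>\<^sup>\<sharp>) + \<delta>\<^sup>2 g\<^sup>-\<^sup>1(\<theta>', \<theta>J) R(\<theta>\<^sup>\<sharp>, J \<theta>\<^sup>\<sharp>)\<close> of the tangent space at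
  \<open>\<gamma> t\<close>, in the components of the chart \<open>c\<close>.\<close>

definition berger_curvature_along ::
  "(('a, 'e::euclidean_space) chart \<Rightarrow> 'e \<Rightarrow> 'e \<Rightarrow> 'e) \<Rightarrow>
   (('a, 'e) chart \<Rightarrow> 'e \<Rightarrow> 'e \<Rightarrow> 'e \<Rightarrow> real) \<Rightarrow> real \<Rightarrow> (real \<Rightarrow> 'a) \<Rightarrow>
   (real \<Rightarrow> ('a, 'e) chart \<Rightarrow> 'e) \<Rightarrow> real \<Rightarrow> ('a, 'e) chart \<Rightarrow> 'e \<Rightarrow> 'e" where
  "berger_curvature_along J g \<delta> \<gamma> \<theta> t c Z =
     (let y = chart_map c (\<gamma> t); R = curvature (g c) y; Jy = J c y;
          \<omega> = \<theta> t c; \<omega>' = covec_deriv g \<gamma> \<theta> t c;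
          v = sharp (g c) y \<omega>; v' = sharp (g c) y \<omega>'
      in R v' v Z + (\<delta>\<^sup>2 * ginv (g c) y \<omega>' (covec_comp \<omega> Jy)) *\<^sub>R R v (Jy v) Z)"

end

theory Submission
  imports Defs
begin

text \<open>
  Write \<open>v\<close> for the vector dual to \<open>\<theta>\<close> and \<open>w = \<nabla>v\<close>, the vector dual to \<open>\<theta>'\<close>.  Only the part of the
  geodesic equation tested against vertical vectors is needed: with \<open>\<beta> = g(w, Jv)\<close> it reads
  \<open>\<nabla>w = -\<delta>\<^sup>2 (\<beta>' Jv + 2 \<beta> Jw)\<close>.  The dual vector of \<open>\<theta>J\<close> is \<open>-Jv\<close>, so the endomorphism is
  \<open>R(w, v) - \<delta>\<^sup>2 \<beta> R(v, Jv)\<close>.  Since \<open>R\<close> and \<open>J\<close> are parallel, its covariant derivative is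
  \<open>R(\<nabla>w, v) - \<delta>\<^sup>2 \<beta>' R(v, Jv) - \<delta>\<^sup>2 \<beta> (R(w, Jv) + R(v, Jw))\<close>, which vanishes because
  \<open>R(JX, JY) = R(X, Y)\<close> gives \<open>R(w, Jv) = R(v, Jw)\<close>.
\<close>

section \<open>Calculus of repeatedly differentiable maps\<close>

text \<open>The Levi-Civita connection of \<open>h\<close> is never computed. For a geodesic with
  velocity Z and a constant coordinate field V, metric compatibility and symmetry of the connection
  give d/dt h(Z, V) = (1/2) (d_V h)(Z, Z), the Euler-Lagrange equation of the energy. For V = (0,
  \<omega>) the left side differentiates the fibre momentum w + \<delta>^2 \<beta> Jv, and the right
  side records how the energy depends on p. That dependence has two sources: the Christoffel term
  inside w and the factor Jv in the fibre metric. The second yields one copy of \<delta>^2 \<beta>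
  Jw and the derivative of the momentum the other, whence the factor 2. The J-invariance of R comes
  from pair symmetry and from R commuting with J, and both rest on the symmetry of second
  derivatives. One coordinate theory serves the base metric and \<open>h\<close>, as two instances
  of \<open>metric_domain\<close>. Its obstacle is that \<open>christoffel\<close> is a definite
  description while the curvature differentiates it, so smoothness has to be obtained through
  \<open>sharp\<close>.\<close>

abbreviation dd :: "('b::real_normed_vector \<Rightarrow> 'c::real_normed_vector) \<Rightarrow> 'b \<Rightarrow> 'b \<Rightarrow> 'c"
  where "dd f x v \<equiv> frechet_derivative f (at x) v"

lemma dd_eqI: "(f has_derivative f') (at x) \<Longrightarrow> dd f x v = f' v"
  using frechet_derivative_at by metis

lemma linear_dd: "f differentiable (at x) \<Longrightarrow> linear (dd f x)"
  using frechet_derivative_works has_derivative_linear by blast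

lemma has_derivative_dd: "f differentiable (at x) \<Longrightarrow> (f has_derivative dd f x) (at x)"
  using frechet_derivative_works by blast

text \<open>On an open set the derivative at a point depends only on values in the set. The closure
  properties below use this to replace \<open>frechet_derivative\<close> by the sum or product
  formula, which is known only on \<open>S\<close>.\<close>

lemma Ck_on_cong:
  assumes "open S" "\<And>x. x \<in> S \<Longrightarrow> f x = g x" "Ck_on k S f"
  shows "Ck_on k S g"
  using assms(2,3)
proof (induction k arbitrary: f g)
  case 0
  then show ?case by (simp cong: continuous_on_cong)
next
  case (Suc k)
  have d: "(g has_derivative dd f x) (at x)" if "x \<in> S" for x
    using has_derivative_transform_within_open[OF has_derivative_dd \<open>open S\<close> that] Suc.prems that
    by auto
  have "dd f x v = dd g x v" if "x \<in> S" for x v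
    using d[OF that] dd_eqI by metis
  then have "Ck_on k S (\<lambda>x. dd g x v)" for v
    using Suc.IH[of "\<lambda>x. dd f x v" "\<lambda>x. dd g x v"] Suc.prems(2) by simp
  then show ?case using d[THEN differentiableI] by auto
qed

lemma Ck_on_imp_continuous_on: "Ck_on k S f \<Longrightarrow> continuous_on S f"
  by (cases k)
     (auto intro!: differentiable_imp_continuous_on differentiable_at_imp_differentiable_on)

lemma Ck_on_SucD: "Ck_on (Suc k) S f \<Longrightarrow> Ck_on k S f"
proof (induction k arbitrary: f)
  case 0
  then show ?case using Ck_on_imp_continuous_on by (metis Ck_on.simps(1))
next
  case (Suc k)
  then show ?case by (metis Ck_on.simps(2))
qed

lemma Ck_on_const: "Ck_on k S (\<lambda>x. c)"
  by (induction k arbitrary: c) auto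

lemma Ck_on_bounded_linear:
  assumes "open S" "bounded_linear L" "Ck_on k S f"
  shows "Ck_on k S (\<lambda>x. L (f x))"
  using assms(3)
proof (induction k arbitrary: f)
  case 0
  then show ?case using assms(2) by (simp add: bounded_linear.continuous_on)
next
  case (Suc k)
  have d: "((\<lambda>x. L (f x)) has_derivative (\<lambda>v. L (dd f x v))) (at x)" if "x \<in> S" for x
    using bounded_linear.has_derivative[OF assms(2) has_derivative_dd] Suc.prems that by auto
  have "Ck_on k S (\<lambda>x. dd (\<lambda>x. L (f x)) x v)" for v
    by (rule Ck_on_cong[OF assms(1) _ Suc.IH[of "\<lambda>x. dd f x v"]])
       (use dd_eqI[OF d] Suc.prems in auto)
  then show ?case using d[THEN differentiableI] by auto
qed

lemma Ck_on_add:
  assumes "open S" "Ck_on k S f" "Ck_on k S g"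
  shows "Ck_on k S (\<lambda>x. f x + g x)"
  using assms(2,3)
proof (induction k arbitrary: f g)
  case 0
  then show ?case by (simp add: continuous_on_add)
next
  case (Suc k)
  have d: "((\<lambda>x. f x + g x) has_derivative (\<lambda>v. dd f x v + dd g x v)) (at x)" if "x \<in> S" for x
    using has_derivative_add[OF has_derivative_dd[of f] has_derivative_dd[of g]] Suc.prems that by auto
  have "Ck_on k S (\<lambda>x. dd (\<lambda>x. f x + g x) x v)" for v
    by (rule Ck_on_cong[OF assms(1) _ Suc.IH[of "\<lambda>x. dd f x v" "\<lambda>x. dd g x v"]])
       (use dd_eqI[OF d] Suc.prems in auto)
  then show ?case using d[THEN differentiableI] by auto
qed

lemma Ck_on_sum:
  assumes "open S" "\<And>i. i \<in> B \<Longrightarrow> Ck_on k S (f i)"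
  shows "Ck_on k S (\<lambda>x. \<Sum>i\<in>B. f i x)"
  using assms(2)
proof (induction B rule: infinite_finite_induct)
  case (insert i B)
  then show ?case using Ck_on_add[OF assms(1), of k "f i" "\<lambda>x. \<Sum>i\<in>B. f i x"] by simp
qed (auto intro: Ck_on_const)

lemma Ck_on_scaleR:
  assumes "open S" "Ck_on k S f" "Ck_on k S g"
  shows "Ck_on k S (\<lambda>x. f x *\<^sub>R g x)"
  using assms(2,3)
proof (induction k arbitrary: f g)
  case 0
  then show ?case by (simp add: continuous_on_scaleR)
next
  case (Suc k)
  have d: "((\<lambda>x. f x *\<^sub>R g x) has_derivative (\<lambda>v. f x *\<^sub>R dd g x v + dd f x v *\<^sub>R g x)) (at x)"
    if "x \<in> S" for x
    using has_derivative_scaleR[OF has_derivative_dd[of f] has_derivative_dd[of g]] Suc.prems that by auto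
  \<comment> \<open>The product rule leaves one factor undifferentiated, and the induction
    hypothesis needs that factor at order \<open>k\<close>.\<close>
  have k: "Ck_on k S f" "Ck_on k S g" using Suc.prems Ck_on_SucD by blast+
  have "Ck_on k S (\<lambda>x. dd (\<lambda>x. f x *\<^sub>R g x) x v)" for v
    by (rule Ck_on_cong[OF assms(1) _ Ck_on_add[OF assms(1)
              Suc.IH[of f "\<lambda>x. dd g x v"] Suc.IH[of "\<lambda>x. dd f x v" g]]])
       (use dd_eqI[OF d] Suc.prems k in auto)
  then show ?case using d[THEN differentiableI] by auto
qed

lemma smooth_on_differentiable: "smooth_on S f \<Longrightarrow> x \<in> S \<Longrightarrow> f differentiable (at x)"
  using Ck_on.simps(2)[of 0 S f] by (auto simp: smooth_on_def)

lemma smooth_on_dd: "smooth_on S f \<Longrightarrow> smooth_on S (\<lambda>x. dd f x v)"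
  unfolding smooth_on_def using Ck_on.simps(2)[of _ S f] by blast

lemma smooth_on_continuous_on: "smooth_on S f \<Longrightarrow> continuous_on S f"
  by (simp add: smooth_on_def Ck_on_imp_continuous_on)

lemma smooth_on_cong:
  "open S \<Longrightarrow> (\<And>x. x \<in> S \<Longrightarrow> f x = g x) \<Longrightarrow> smooth_on S f \<Longrightarrow> smooth_on S g"
  unfolding smooth_on_def by (intro allI, rule Ck_on_cong[of S f g]) auto

lemma smooth_on_const: "smooth_on S (\<lambda>x. c)"
  by (simp add: smooth_on_def Ck_on_const)

lemma smooth_on_bounded_linear:
  "open S \<Longrightarrow> bounded_linear L \<Longrightarrow> smooth_on S f \<Longrightarrow> smooth_on S (\<lambda>x. L (f x))"
  by (simp add: smooth_on_def Ck_on_bounded_linear)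

lemma smooth_on_add:
  "open S \<Longrightarrow> smooth_on S f \<Longrightarrow> smooth_on S g \<Longrightarrow> smooth_on S (\<lambda>x. f x + g x)"
  by (simp add: smooth_on_def Ck_on_add)

lemma smooth_on_sum:
  "open S \<Longrightarrow> (\<And>i. i \<in> B \<Longrightarrow> smooth_on S (f i)) \<Longrightarrow> smooth_on S (\<lambda>x. \<Sum>i\<in>B. f i x)"
  by (simp add: smooth_on_def Ck_on_sum)

lemma smooth_on_scaleR:
  "open S \<Longrightarrow> smooth_on S f \<Longrightarrow> smooth_on S g \<Longrightarrow> smooth_on S (\<lambda>x. f x *\<^sub>R g x)"
  by (simp add: smooth_on_def Ck_on_scaleR)

lemma smooth_on_diff:
  assumes "open S" "smooth_on S f" "smooth_on S g"
  shows "smooth_on S (\<lambda>x. f x - g x)"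
  using smooth_on_add[OF assms(1,2) smooth_on_scaleR[OF assms(1) smooth_on_const[of S "-1"] assms(3)]]
  by simp

text \<open>The mean value theorem in the direction \<open>u\<close> and then in the direction \<open>v\<close> turns the
  second difference quotient into a value of \<open>\<partial>\<^sub>v \<partial>\<^sub>u f\<close> near \<open>y\<close>.\<close>

lemma second_difference_tendsto:
  fixes f :: "'b::euclidean_space \<Rightarrow> real"
  assumes "smooth_on S f" "open S" "y \<in> S"
  shows "((\<lambda>h. (f (y + h *\<^sub>R u + h *\<^sub>R v) - f (y + h *\<^sub>R u) - f (y + h *\<^sub>R v) + f y) / h\<^sup>2)
      \<longlongrightarrow> dd (\<lambda>x. dd f x u) y v) (at_right 0)"
proof (rule tendstoI)
  fix e :: real assume "e > 0"
  let ?g = "\<lambda>x. dd (\<lambda>x. dd f x u) x v"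
  let ?q = "\<lambda>h. (f (y + h *\<^sub>R u + h *\<^sub>R v) - f (y + h *\<^sub>R u) - f (y + h *\<^sub>R v) + f y) / h\<^sup>2"
  have su: "smooth_on S (\<lambda>x. dd f x u)" using assms(1) smooth_on_dd by blast
  have "continuous_on S ?g" using su smooth_on_dd smooth_on_continuous_on by blast
  then have "isCont ?g y" using assms continuous_on_eq_continuous_at by blast
  then obtain d1 where d1: "d1 > 0" "\<And>p. dist p y < d1 \<Longrightarrow> dist (?g p) (?g y) < e"
    using \<open>e > 0\<close> unfolding continuous_at_eps_delta by blast
  obtain d2 where d2: "d2 > 0" "ball y d2 \<subseteq> S" using assms openE by blast
  define d where "d = min d1 d2"
  \<comment> \<open>For \<open>h < r\<close> the whole parallelogram spanned by \<open>h u\<close>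
    and \<open>h v\<close> at \<open>y\<close> lies within distance \<open>d\<close>, hence in
    \<open>S\<close> and in the range of the continuity estimate. The summand 1 keeps the
    denominator positive when \<open>u = v = 0\<close>.\<close>
  define r where "r = d / (norm u + norm v + 1)"
  have pos: "norm u + norm v + 1 > 0" by (smt (verit) norm_ge_zero)
  have "r > 0" using d1 d2 pos unfolding r_def d_def by simp
  have near: "dist (y + a *\<^sub>R u + b *\<^sub>R v) y < d" if "0 \<le> a" "a \<le> h" "0 \<le> b" "b \<le> h" "h < r" for a b h
  proof -
    have "dist (y + a *\<^sub>R u + b *\<^sub>R v) y = norm (a *\<^sub>R u + b *\<^sub>R v)" by (simp add: dist_norm)
    also have "\<dots> \<le> a * norm u + b * norm v" using that norm_triangle_ineq[of "a *\<^sub>R u" "b *\<^sub>R v"] by simp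
    also have "\<dots> \<le> h * norm u + h * norm v"
      using that by (intro add_mono mult_right_mono) auto
    also have "\<dots> \<le> h * (norm u + norm v + 1)" using that by (simp add: algebra_simps)
    also have "\<dots> < r * (norm u + norm v + 1)" using that pos by (intro mult_strict_right_mono)
    also have "\<dots> = d" using pos unfolding r_def by simp
    finally show ?thesis .
  qed
  have inS: "y + a *\<^sub>R u + b *\<^sub>R v \<in> S" if "0 \<le> a" "a \<le> h" "0 \<le> b" "b \<le> h" "h < r" for a b h
    using near[OF that] d2(2) by (auto simp: d_def dist_commute subset_eq)
  have line: "((\<lambda>a. F (p + a *\<^sub>R w + c)) has_real_derivative dd F (p + a *\<^sub>R w + c) w) (at a)"
    if "F differentiable (at (p + a *\<^sub>R w + c))" for F :: "'b \<Rightarrow> real" and p w c a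
  proof -
    have "((\<lambda>a. p + a *\<^sub>R w + c) has_derivative (\<lambda>t. t *\<^sub>R w)) (at a)"
      by (auto intro!: derivative_eq_intros)
    from has_derivative_compose[OF this has_derivative_dd[OF that]]
    show ?thesis
      using linear_dd[OF that]
      by (simp add: has_field_derivative_def linear_cmul mult_commute_abs)
  qed
  have "dist (?q h) (?g y) < e" if h: "0 < h" "h < r" for h
  proof -
    \<comment> \<open>The \<open>+ 0\<close> gives the second term the shape
      \<open>p + a *\<^sub>R w + c\<close> that \<open>line\<close> expects.\<close>
    let ?\<phi> = "\<lambda>a. f (y + a *\<^sub>R u + h *\<^sub>R v) - f (y + a *\<^sub>R u + 0)"
    let ?\<phi>' = "\<lambda>a. dd f (y + a *\<^sub>R u + h *\<^sub>R v) u - dd f (y + a *\<^sub>R u + 0) u"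
    have "DERIV ?\<phi> a :> ?\<phi>' a" if "0 \<le> a" "a \<le> h" for a
      by (intro DERIV_diff line smooth_on_differentiable[OF assms(1)])
         (use inS[of a h h] inS[of a h 0] that h in auto)
    from MVT2[OF h(1) this] obtain \<xi> where \<xi>: "0 < \<xi>" "\<xi> < h" "?\<phi> h - ?\<phi> 0 = h * ?\<phi>' \<xi>"
      by auto
    let ?\<psi> = "\<lambda>b. dd f ((y + \<xi> *\<^sub>R u) + b *\<^sub>R v + 0) u"
    let ?\<psi>' = "\<lambda>b. ?g ((y + \<xi> *\<^sub>R u) + b *\<^sub>R v + 0)"
    have "DERIV ?\<psi> b :> ?\<psi>' b" if "0 \<le> b" "b \<le> h" for b
      by (rule line, rule smooth_on_differentiable[OF su])
         (use inS[of \<xi> h b] that h \<xi> in auto)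
    from MVT2[OF h(1) this] obtain \<eta> where \<eta>: "0 < \<eta>" "\<eta> < h" "?\<psi> h - ?\<psi> 0 = h * ?\<psi>' \<eta>"
      by auto
    have "?q h = ?g (y + \<xi> *\<^sub>R u + \<eta> *\<^sub>R v)"
      using \<xi>(3) \<eta>(3) h by (simp add: power2_eq_square field_simps)
    then show ?thesis
      using d1(2) near[of \<xi> h \<eta>] \<xi> \<eta> h by (simp add: d_def)
  qed
  then show "eventually (\<lambda>h. dist (?q h) (?g y) < e) (at_right 0)"
    using \<open>r > 0\<close> unfolding eventually_at_right_field by auto
qed

text \<open>The second difference quotient is symmetric in \<open>u\<close> and \<open>v\<close>, so
  both mixed derivatives are its limit.\<close>

lemma dd_commute_real:
  fixes f :: "'b::euclidean_space \<Rightarrow> real"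
  assumes "smooth_on S f" "open S" "y \<in> S"
  shows "dd (\<lambda>x. dd f x u) y v = dd (\<lambda>x. dd f x v) y u"
proof -
  have "(\<lambda>h. (f (y + h *\<^sub>R v + h *\<^sub>R u) - f (y + h *\<^sub>R v) - f (y + h *\<^sub>R u) + f y) / h\<^sup>2)
      = (\<lambda>h. (f (y + h *\<^sub>R u + h *\<^sub>R v) - f (y + h *\<^sub>R u) - f (y + h *\<^sub>R v) + f y) / h\<^sup>2)"
    by (auto simp: fun_eq_iff algebra_simps)
  then show ?thesis
    using tendsto_unique[OF trivial_limit_at_right_real second_difference_tendsto[OF assms, of u v]]
      second_difference_tendsto[OF assms, of v u] by simp
qed

lemma dd_inner:
  fixes f :: "'b::real_normed_vector \<Rightarrow> 'c::real_inner"
  shows "f differentiable (at x) \<Longrightarrow> dd (\<lambda>x. f x \<bullet> i) x v = dd f x v \<bullet> i"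
  by (rule dd_eqI) (auto intro!: derivative_eq_intros has_derivative_dd)

text \<open>Both functions have the same set of derivatives at \<open>x\<close>, and
  \<open>frechet_derivative\<close> is a choice from that set.\<close>

lemma dd_cong:
  assumes "open S" "x \<in> S" "\<And>y. y \<in> S \<Longrightarrow> f y = g y"
  shows "dd f x v = dd g x v"
proof -
  have "(f has_derivative D) (at x) \<longleftrightarrow> (g has_derivative D) (at x)" for D
    using has_derivative_transform_within_open[OF _ assms(1,2)] assms(3) by metis
  then show ?thesis by (simp add: frechet_derivative_def)
qed

lemma dd_commute:
  fixes f :: "'b::euclidean_space \<Rightarrow> 'c::euclidean_space"
  assumes "smooth_on S f" "open S" "y \<in> S"
  shows "dd (\<lambda>x. dd f x u) y v = dd (\<lambda>x. dd f x v) y u"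
proof (rule euclidean_eqI)
  fix i :: 'c
  let ?f = "\<lambda>x. f x \<bullet> i"
  have s: "smooth_on S ?f" by (rule smooth_on_bounded_linear) (use assms in \<open>auto intro: bounded_linear_inner_left\<close>)
  have *: "dd (\<lambda>x. dd f x a) y b \<bullet> i = dd (\<lambda>x. dd ?f x a) y b" for a b
  proof -
    have "dd (\<lambda>x. dd f x a) y b \<bullet> i = dd (\<lambda>x. dd f x a \<bullet> i) y b"
      using dd_inner smooth_on_differentiable[OF smooth_on_dd[OF assms(1)] assms(3)] by metis
    also have "\<dots> = dd (\<lambda>x. dd ?f x a) y b"
      using assms by (intro dd_cong[OF assms(2,3)]) (auto simp: dd_inner smooth_on_differentiable)
    finally show ?thesis .
  qed
  show "dd (\<lambda>x. dd f x u) y v \<bullet> i = dd (\<lambda>x. dd f x v) y u \<bullet> i"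
    unfolding * using dd_commute_real[OF s assms(2,3)] .
qed

section \<open>Families of linear and bilinear maps\<close>

lemma linear_expand:
  fixes T :: "'b::euclidean_space \<Rightarrow> 'c::real_vector"
  assumes "linear T"
  shows "T u = (\<Sum>i\<in>Basis. (u \<bullet> i) *\<^sub>R T i)"
proof -
  have "T (\<Sum>i\<in>Basis. (u \<bullet> i) *\<^sub>R i) = (\<Sum>i\<in>Basis. T ((u \<bullet> i) *\<^sub>R i))"
    using linear_sum[OF assms] .
  also have "\<dots> = (\<Sum>i\<in>Basis. (u \<bullet> i) *\<^sub>R T i)" by (simp add: linear_cmul[OF assms])
  finally show ?thesis by (simp only: euclidean_representation)
qed

text \<open>Tensor components are known to be differentiable only for fixed arguments. Expanding the
  argument in the basis turns \<open>T (x s) (v s)\<close> into a finite sum of products of a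
  coordinate of \<open>v\<close> and such a component, so the product rule applies.\<close>

lemma has_derivative_linear_family:
  fixes T :: "'b::real_normed_vector \<Rightarrow> 'e::euclidean_space \<Rightarrow> 'c::real_normed_vector"
  assumes lin: "\<And>y. y \<in> U \<Longrightarrow> linear (T y)" and "open U"
    and diff: "\<And>i. i \<in> Basis \<Longrightarrow> (\<lambda>y. T y i) differentiable (at (x t))"
    and x: "(x has_derivative x') (at t)" and v: "(v has_derivative v') (at t)" and "x t \<in> U"
  shows "(\<lambda>y. T y u) differentiable (at (x t))"
    and "((\<lambda>s. T (x s) (v s)) has_derivative (\<lambda>h. dd (\<lambda>y. T y (v t)) (x t) (x' h) + T (x t) (v' h))) (at t)"
proof -
  have d: "((\<lambda>y. T y u) has_derivative (\<lambda>h. \<Sum>i\<in>Basis. (u \<bullet> i) *\<^sub>R dd (\<lambda>y. T y i) (x t) h)) (at (x t))" for u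
  proof (rule has_derivative_transform_within_open[OF _ \<open>open U\<close> \<open>x t \<in> U\<close>])
    show "((\<lambda>y. \<Sum>i\<in>Basis. (u \<bullet> i) *\<^sub>R T y i) has_derivative (\<lambda>h. \<Sum>i\<in>Basis. (u \<bullet> i) *\<^sub>R dd (\<lambda>y. T y i) (x t) h)) (at (x t))"
      using diff by (intro has_derivative_sum has_derivative_scaleR_right has_derivative_dd)
  qed (simp add: linear_expand[OF lin, of _ u])
  then show "(\<lambda>y. T y u) differentiable (at (x t))" using differentiable_def by blast
  have cx: "isCont x t" using has_derivative_continuous[OF x] .
  obtain V where V: "open V" "t \<in> V" "\<And>s. s \<in> V \<Longrightarrow> x s \<in> U"
    using continuous_at_open[THEN iffD1, OF cx, rule_format, of U] assms(2,6) by auto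
  have "((\<lambda>s. \<Sum>i\<in>Basis. (v s \<bullet> i) *\<^sub>R T (x s) i) has_derivative
      (\<lambda>h. \<Sum>i\<in>Basis. (v t \<bullet> i) *\<^sub>R dd (\<lambda>y. T y i) (x t) (x' h) + (v' h \<bullet> i) *\<^sub>R T (x t) i)) (at t)"
  proof (rule has_derivative_sum)
    fix i :: 'e assume "i \<in> Basis"
    show "((\<lambda>s. (v s \<bullet> i) *\<^sub>R T (x s) i) has_derivative
        (\<lambda>h. (v t \<bullet> i) *\<^sub>R dd (\<lambda>y. T y i) (x t) (x' h) + (v' h \<bullet> i) *\<^sub>R T (x t) i)) (at t)"
      using has_derivative_scaleR[OF has_derivative_inner_left[OF v]
          has_derivative_compose[OF x has_derivative_dd[OF diff[OF \<open>i \<in> Basis\<close>]]]] .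
  qed
  also have "(\<lambda>h. \<Sum>i\<in>Basis. (v t \<bullet> i) *\<^sub>R dd (\<lambda>y. T y i) (x t) (x' h) + (v' h \<bullet> i) *\<^sub>R T (x t) i)
      = (\<lambda>h. dd (\<lambda>y. T y (v t)) (x t) (x' h) + T (x t) (v' h))"
  proof (rule ext)
    fix h
    have "T (x t) (v' h) = (\<Sum>i\<in>Basis. (v' h \<bullet> i) *\<^sub>R T (x t) i)"
      using linear_expand[OF lin[OF \<open>x t \<in> U\<close>]] .
    then show "(\<Sum>i\<in>Basis. (v t \<bullet> i) *\<^sub>R dd (\<lambda>y. T y i) (x t) (x' h) + (v' h \<bullet> i) *\<^sub>R T (x t) i)
        = dd (\<lambda>y. T y (v t)) (x t) (x' h) + T (x t) (v' h)"
      using dd_eqI[OF d[of "v t"], of "x' h"] by (simp add: sum.distrib)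
  qed
  finally have "((\<lambda>s. \<Sum>i\<in>Basis. (v s \<bullet> i) *\<^sub>R T (x s) i) has_derivative
      (\<lambda>h. dd (\<lambda>y. T y (v t)) (x t) (x' h) + T (x t) (v' h))) (at t)" .
  then show "((\<lambda>s. T (x s) (v s)) has_derivative
      (\<lambda>h. dd (\<lambda>y. T y (v t)) (x t) (x' h) + T (x t) (v' h))) (at t)"
  proof (rule has_derivative_transform_within_open[OF _ V(1,2)])
    fix s assume "s \<in> V"
    show "(\<Sum>i\<in>Basis. (v s \<bullet> i) *\<^sub>R T (x s) i) = T (x s) (v s)"
      by (rule linear_expand[OF lin[OF V(3)[OF \<open>s \<in> V\<close>]], symmetric])
  qed
qed

lemma linear_dd_family:
  fixes T :: "'b::real_normed_vector \<Rightarrow> 'e::euclidean_space \<Rightarrow> 'c::real_normed_vector"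
  assumes lin: "\<And>y. y \<in> U \<Longrightarrow> linear (T y)" and "open U" "y \<in> U"
    and diff: "\<And>u. (\<lambda>y. T y u) differentiable (at y)"
  shows "linear (\<lambda>u. dd (\<lambda>y. T y u) y a)"
proof (rule linearI)
  fix u v :: 'e and r :: real
  have "dd (\<lambda>y. T y (u + v)) y a = dd (\<lambda>y. T y u + T y v) y a"
    by (rule dd_cong[OF assms(2,3)]) (simp add: lin linear_add)
  also have "\<dots> = dd (\<lambda>y. T y u) y a + dd (\<lambda>y. T y v) y a"
    by (rule dd_eqI[OF has_derivative_add[OF has_derivative_dd[OF diff] has_derivative_dd[OF diff]]])
  finally show "dd (\<lambda>y. T y (u + v)) y a = dd (\<lambda>y. T y u) y a + dd (\<lambda>y. T y v) y a" .
  have "dd (\<lambda>y. T y (r *\<^sub>R u)) y a = dd (\<lambda>y. r *\<^sub>R T y u) y a"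
    by (rule dd_cong[OF assms(2,3)]) (simp add: lin linear_cmul)
  also have "\<dots> = r *\<^sub>R dd (\<lambda>y. T y u) y a"
    by (rule dd_eqI[OF has_derivative_scaleR_right[OF has_derivative_dd[OF diff]]])
  finally show "dd (\<lambda>y. T y (r *\<^sub>R u)) y a = r *\<^sub>R dd (\<lambda>y. T y u) y a" .
qed

text \<open>The linear case is used twice: for a fixed first argument, and then for the maps
  \<open>u \<mapsto> B y u v\<close> with the pair \<open>(y, v)\<close> as the parameter.\<close>

lemma has_derivative_bilinear_family:
  fixes B :: "'b::real_normed_vector \<Rightarrow> 'e::euclidean_space \<Rightarrow> 'f::euclidean_space \<Rightarrow> 'c::real_normed_vector"
  assumes bil: "\<And>y. y \<in> U \<Longrightarrow> bilinear (B y)" and "open U"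
    and diff: "\<And>i j. i \<in> Basis \<Longrightarrow> j \<in> Basis \<Longrightarrow> (\<lambda>y. B y i j) differentiable (at (x t))"
    and x: "(x has_derivative x') (at t)" and u: "(u has_derivative u') (at t)"
    and v: "(v has_derivative v') (at t)" and "x t \<in> U"
  shows "(\<lambda>y. B y a b) differentiable (at (x t))"
    and "((\<lambda>s. B (x s) (u s) (v s)) has_derivative
      (\<lambda>h. dd (\<lambda>y. B y (u t) (v t)) (x t) (x' h) + B (x t) (u t) (v' h) + B (x t) (u' h) (v t))) (at t)"
proof -
  have linl: "linear (\<lambda>u. B y u v)" and linr: "linear (B y u)" if "y \<in> U" for y u v
    using bil[OF that] by (auto simp: bilinear_def)
  have d1: "(\<lambda>y. B y a j) differentiable (at (x t))" if "j \<in> Basis" for a j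
    by (rule has_derivative_linear_family(1)[OF linl \<open>open U\<close> diff x u \<open>x t \<in> U\<close>]) (use that in auto)
  show "(\<lambda>y. B y a b) differentiable (at (x t))"
    by (rule has_derivative_linear_family(1)[OF linr \<open>open U\<close> d1 x v \<open>x t \<in> U\<close>]) auto
  have d2: "((\<lambda>p. B (fst p) a (snd p)) has_derivative
      (\<lambda>h. dd (\<lambda>y. B y a (v t)) (x t) (fst h) + B (x t) a (snd h))) (at (x t, v t))" for a
    using has_derivative_linear_family(2)[where T = "\<lambda>y. B y a" and x = fst and v = snd
        and t = "(x t, v t)" and x' = fst and v' = snd and U = U] linr \<open>open U\<close> d1 \<open>x t \<in> U\<close>
    by (simp add: bounded_linear_fst bounded_linear_imp_has_derivative bounded_linear_snd)
  have U2: "open (U \<times> (UNIV :: 'f set))" using \<open>open U\<close> by (simp add: open_Times)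
  have "((\<lambda>s. B (fst (x s, v s)) (u s) (snd (x s, v s))) has_derivative
     (\<lambda>h. dd (\<lambda>p. B (fst p) (u t) (snd p)) (x t, v t) (x' h, v' h) + B (fst (x t, v t)) (u' h) (snd (x t, v t)))) (at t)"
    by (rule has_derivative_linear_family(2)[where T = "\<lambda>p u. B (fst p) u (snd p)" and U = "U \<times> UNIV"])
       (use linl U2 d2[THEN differentiableI] x v u \<open>x t \<in> U\<close> in \<open>auto intro: has_derivative_Pair\<close>)
  then show "((\<lambda>s. B (x s) (u s) (v s)) has_derivative
      (\<lambda>h. dd (\<lambda>y. B y (u t) (v t)) (x t) (x' h) + B (x t) (u t) (v' h) + B (x t) (u' h) (v t))) (at t)"
    by (simp add: dd_eqI[OF d2])
qed

section \<open>Riemannian geometry in a coordinate domain\<close>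

locale metric_domain =
  fixes U :: "'e::euclidean_space set" and G :: "'e \<Rightarrow> 'e \<Rightarrow> 'e \<Rightarrow> real"
  assumes open_domain: "open U"
    and bilinear_metric: "y \<in> U \<Longrightarrow> bilinear (G y)"
    and metric_sym: "y \<in> U \<Longrightarrow> G y u v = G y v u"
    and metric_pos: "y \<in> U \<Longrightarrow> u \<noteq> 0 \<Longrightarrow> G y u u > 0"
    and smooth_metric: "smooth_on U (\<lambda>y. G y u v)"
begin

lemma metric_linear: "y \<in> U \<Longrightarrow> linear (G y u)" "y \<in> U \<Longrightarrow> linear (\<lambda>u. G y u v)"
  using bilinear_metric by (auto simp: bilinear_def)

lemmas metric_linear_simps =
  linear_add[OF metric_linear(1)] linear_add[OF metric_linear(2)]
  linear_diff[OF metric_linear(1)] linear_diff[OF metric_linear(2)]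
  linear_neg[OF metric_linear(1)] linear_neg[OF metric_linear(2)]
  linear_cmul[OF metric_linear(1)] linear_cmul[OF metric_linear(2)]
  linear_0[OF metric_linear(1)] linear_0[OF metric_linear(2)]

lemma metric_eqI:
  assumes "y \<in> U" "\<And>w. G y u w = G y v w"
  shows "u = v"
proof (rule ccontr)
  assume "u \<noteq> v"
  then have "G y (u - v) (u - v) > 0" using metric_pos assms(1) by simp
  then show False using assms(2)[of "u - v"] by (simp add: metric_linear_simps assms(1))
qed

text \<open>Lowering an index. Unlike its inverse \<open>sharp\<close>, this map is explicit in the
  components of \<open>G\<close>, so its smoothness is immediate.\<close>

definition lower :: "'e \<Rightarrow> 'e \<Rightarrow> 'e" where
  "lower y v = (\<Sum>i\<in>Basis. G y v i *\<^sub>R i)"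

lemma lower_inner: "y \<in> U \<Longrightarrow> lower y v \<bullet> w = G y v w"
  unfolding lower_def inner_sum_left inner_scaleR_left
  using linear_expand[OF metric_linear(1), of y v w] by (simp add: inner_commute mult.commute)

lemma linear_lower: "y \<in> U \<Longrightarrow> linear (lower y)"
  by (rule linearI)
     (auto simp: lower_def metric_linear_simps scaleR_add_left sum.distrib scaleR_sum_right)

lemma smooth_lower: "smooth_on U (\<lambda>y. lower y v)"
  unfolding lower_def
  by (intro smooth_on_sum smooth_on_scaleR open_domain smooth_metric smooth_on_const)

lemma sharp_eqI:
  assumes "y \<in> U" "\<And>u. G y v u = \<omega> \<bullet> u"
  shows "sharp G y \<omega> = v"
  unfolding sharp_def by (rule the_equality) (use assms metric_eqI in auto)

lemma sharp_lower: "y \<in> U \<Longrightarrow> sharp G y (lower y v) = v"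
  by (simp add: sharp_eqI lower_inner)

text \<open>This contains the existence half of the definite description in \<open>sharp\<close>: an
  injective linear endomorphism of a finite-dimensional space is onto.\<close>

lemma lower_sharp:
  assumes "y \<in> U" shows "lower y (sharp G y \<omega>) = \<omega>"
proof -
  have "inj (lower y)" using sharp_lower[OF assms] by (metis injI)
  then have "surj (lower y)" using linear_injective_imp_surjective linear_lower assms by blast
  then obtain v where "\<omega> = lower y v" by blast
  then show ?thesis using sharp_lower assms by simp
qed

lemma metric_sharp: "y \<in> U \<Longrightarrow> G y (sharp G y \<omega>) u = \<omega> \<bullet> u"
  by (metis lower_inner lower_sharp)

lemma linear_sharp: "y \<in> U \<Longrightarrow> linear (sharp G y)"
  by (rule linearI; rule sharp_eqI) (auto simp: metric_linear_simps metric_sharp inner_add_left)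

text \<open>The inverse function theorem for \<open>(y, v) \<mapsto> (y, lower y v)\<close>.\<close>

lemma has_derivative_sharp_pair:
  assumes "y \<in> U"
  shows "((\<lambda>p. sharp G (fst p) (snd p)) has_derivative
    (\<lambda>h. sharp G y (snd h - dd (\<lambda>z. lower z (sharp G y \<omega>)) y (fst h)))) (at (y, \<omega>))"
proof -
  let ?S = "U \<times> (UNIV :: 'e set)"
  let ?F = "\<lambda>p. (fst p, lower (fst p) (snd p))" and ?H = "\<lambda>p. (fst p, sharp G (fst p) (snd p))"
  have d: "(?F has_derivative (\<lambda>h. (fst h, dd (\<lambda>y. lower y v) y (fst h) + lower y (snd h)))) (at (y, v))"
    if "y \<in> U" for y v
    using has_derivative_linear_family(2)[where T = lower and x = fst and v = snd
        and t = "(y, v)" and x' = fst and v' = snd and U = U] linear_lower open_domain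
      smooth_on_differentiable[OF smooth_lower] that
    by (auto intro!: has_derivative_Pair has_derivative_fst simp: bounded_linear_imp_has_derivative bounded_linear_snd bounded_linear_fst)
  let ?v = "sharp G y \<omega>"
  have "(?H has_derivative (\<lambda>h. (fst h, sharp G y (snd h - dd (\<lambda>y. lower y ?v) y (fst h))))) (at (y, \<omega>))"
  \<comment> \<open>The derivative of \<open>?F\<close> is block triangular, with identity and
    \<open>lower y\<close> on the diagonal, so its inverse can be written down with
    \<open>sharp G y\<close>.\<close>
  proof (rule has_derivative_inverse_strong_x[where f = ?F and S = ?S])
    show "open ?S" using open_domain by (simp add: open_Times)
    show "continuous_on ?S ?F"
      by (rule differentiable_imp_continuous_on, rule differentiable_at_imp_differentiable_on)
         (use d differentiableI in fastforce)
    show "(?F has_derivative (\<lambda>h. (fst h, dd (\<lambda>y. lower y ?v) y (fst h) + lower y (snd h)))) (at (?H (y, \<omega>)))"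
      using d[OF assms] by simp
  qed (use assms in \<open>auto simp: sharp_lower lower_sharp fun_eq_iff\<close>)
  from has_derivative_snd[OF this] show ?thesis by simp
qed

lemma has_derivative_sharp:
  assumes x: "(x has_derivative x') (at t)" and f: "(f has_derivative f') (at t)" and "x t \<in> U"
  shows "((\<lambda>s. sharp G (x s) (f s)) has_derivative
    (\<lambda>h. sharp G (x t) (f' h - dd (\<lambda>y. lower y (sharp G (x t) (f t))) (x t) (x' h)))) (at t)"
  using has_derivative_compose[OF has_derivative_Pair[OF x f] has_derivative_sharp_pair[OF assms(3)]]
  by simp

text \<open>The derivative of \<open>sharp \<circ> f\<close> is again \<open>sharp\<close> of a map,
  built from the derivative of \<open>f\<close> and from \<open>sharp \<circ> f\<close> itself. The
  induction therefore closes when \<open>f\<close> is left general: order \<open>k\<close> of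
  \<open>sharp \<circ> f\<close> gives order \<open>k\<close> of its derivative.\<close>

lemma Ck_on_sharp: "Ck_on k U f \<Longrightarrow> Ck_on k U (\<lambda>y. sharp G y (f y))"
proof (induction k arbitrary: f)
  case 0
  have "continuous_on (U \<times> UNIV) (\<lambda>p. sharp G (fst p) (snd p))"
    by (rule differentiable_imp_continuous_on, rule differentiable_at_imp_differentiable_on)
       (use has_derivative_sharp_pair differentiableI in fastforce)
  moreover have "continuous_on U (\<lambda>y. (y, f y))" using 0 by (simp add: continuous_on_Pair)
  ultimately show ?case
    using continuous_on_compose2[where s = U and t = "U \<times> UNIV" and f = "\<lambda>y. (y, f y)"] by fastforce
next
  case (Suc k)
  let ?s = "\<lambda>y. sharp G y (f y)"
  let ?D = "\<lambda>a y. \<Sum>i\<in>Basis. (?s y \<bullet> i) *\<^sub>R dd (\<lambda>y. lower y i) y a"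
  have d: "(?s has_derivative (\<lambda>a. sharp G y (dd f y a - ?D a y))) (at y)" if "y \<in> U" for y
  proof -
    have "dd (\<lambda>y'. lower y' (?s y)) y a = ?D a y" for a
      by (rule linear_expand[OF linear_dd_family[OF linear_lower open_domain that]])
         (use smooth_on_differentiable[OF smooth_lower that] in auto)
    then show ?thesis
      using has_derivative_sharp[OF has_derivative_ident has_derivative_dd, of f y] Suc.prems that
      by auto
  qed
  have D: "Ck_on k U (?D a)" for a
    using Suc.IH[OF Ck_on_SucD[OF Suc.prems]] smooth_on_dd[OF smooth_lower]
    by (intro Ck_on_sum Ck_on_scaleR open_domain Ck_on_bounded_linear[OF _ bounded_linear_inner_left])
       (auto simp: smooth_on_def)
  have "Ck_on k U (\<lambda>y. dd f y a - ?D a y)" for a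
    using Ck_on_add[OF open_domain, of k "\<lambda>y. dd f y a" "\<lambda>y. - ?D a y"] Suc.prems
      Ck_on_bounded_linear[OF open_domain bounded_linear_minus[OF bounded_linear_ident] D] by auto
  from Suc.IH[OF this] have "Ck_on k U (\<lambda>y. dd ?s y a)" for a
    by (rule Ck_on_cong[OF open_domain, rotated]) (use dd_eqI[OF d] in auto)
  then show ?case using d[THEN differentiableI] by auto
qed

lemma smooth_on_sharp: "smooth_on U f \<Longrightarrow> smooth_on U (\<lambda>y. sharp G y (f y))"
  by (simp add: smooth_on_def Ck_on_sharp)


section \<open>Christoffel symbols and metric compatibility\<close>

lemma differentiable_metric: "y \<in> U \<Longrightarrow> (\<lambda>y. G y u v) differentiable (at y)"
  using smooth_on_differentiable smooth_metric by blast

lemma linear_dd_metric: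
  assumes "y \<in> U"
  shows "linear (\<lambda>u. dd (\<lambda>y. G y u v) y a)" "linear (\<lambda>v. dd (\<lambda>y. G y u v) y a)"
    "linear (dd (\<lambda>y. G y u v) y)"
  using linear_dd_family[OF metric_linear(2) open_domain assms differentiable_metric[OF assms]]
    linear_dd_family[OF metric_linear(1) open_domain assms differentiable_metric[OF assms]]
    linear_dd[OF differentiable_metric[OF assms]] by blast+

lemmas dd_metric_simps =
  linear_add[OF linear_dd_metric(1)] linear_add[OF linear_dd_metric(2)] linear_add[OF linear_dd_metric(3)]
  linear_cmul[OF linear_dd_metric(1)] linear_cmul[OF linear_dd_metric(2)] linear_cmul[OF linear_dd_metric(3)]

lemma dd_metric_sym: "y \<in> U \<Longrightarrow> dd (\<lambda>y. G y u v) y a = dd (\<lambda>y. G y v u) y a"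
  by (rule dd_cong[OF open_domain]) (auto simp: metric_sym)

text \<open>The Christoffel symbols of the first kind as a covector. Through them
  \<open>christoffel\<close> inherits existence and smoothness from \<open>sharp\<close>.\<close>

definition christoffel_lower :: "'e \<Rightarrow> 'e \<Rightarrow> 'e \<Rightarrow> 'e" where
  "christoffel_lower y u v = (\<Sum>w\<in>Basis.
     ((dd (\<lambda>y. G y v w) y u + dd (\<lambda>y. G y u w) y v - dd (\<lambda>y. G y u v) y w) / 2) *\<^sub>R w)"

lemma christoffel_lower_inner:
  assumes "y \<in> U"
  shows "christoffel_lower y u v \<bullet> w
    = (dd (\<lambda>y. G y v w) y u + dd (\<lambda>y. G y u w) y v - dd (\<lambda>y. G y u v) y w) / 2"
proof -
  have "linear (\<lambda>w. (dd (\<lambda>y. G y v w) y u + dd (\<lambda>y. G y u w) y v - dd (\<lambda>y. G y u v) y w) / 2)"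
    by (rule linearI) (auto simp: dd_metric_simps assms field_simps)
  from linear_expand[OF this, of w] show ?thesis
    unfolding christoffel_lower_def inner_sum_left inner_scaleR_left
    by (simp add: inner_commute mult.commute)
qed

lemma christoffel_eq_sharp: "y \<in> U \<Longrightarrow> christoffel G y u v = sharp G y (christoffel_lower y u v)"
  unfolding christoffel_def sharp_def by (simp add: christoffel_lower_inner)

lemma metric_christoffel:
  "y \<in> U \<Longrightarrow> G y (christoffel G y u v) w
    = (dd (\<lambda>y. G y v w) y u + dd (\<lambda>y. G y u w) y v - dd (\<lambda>y. G y u v) y w) / 2"
  by (simp add: christoffel_eq_sharp metric_sharp christoffel_lower_inner)

lemma christoffel_sym: "y \<in> U \<Longrightarrow> christoffel G y u v = christoffel G y v u"
  by (rule metric_eqI) (auto simp: metric_christoffel dd_metric_sym[of y u v])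

lemma bilinear_christoffel:
  assumes "y \<in> U" shows "bilinear (christoffel G y)"
proof -
  have "linear (christoffel G y u)" for u
    by (rule linearI; rule metric_eqI[OF assms])
       (simp_all add: assms metric_christoffel metric_linear_simps dd_metric_simps field_simps)
  moreover have "linear (\<lambda>u. christoffel G y u v)" for v
    by (rule linearI; rule metric_eqI[OF assms])
       (simp_all add: assms metric_christoffel metric_linear_simps dd_metric_simps field_simps)
  ultimately show ?thesis by (simp add: bilinear_def)
qed

lemma christoffel_linear:
  "y \<in> U \<Longrightarrow> linear (christoffel G y u)" "y \<in> U \<Longrightarrow> linear (\<lambda>u. christoffel G y u v)"
  using bilinear_christoffel by (auto simp: bilinear_def)

lemmas christoffel_linear_simps =
  linear_add[OF christoffel_linear(1)] linear_add[OF christoffel_linear(2)]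
  linear_diff[OF christoffel_linear(1)] linear_diff[OF christoffel_linear(2)]
  linear_cmul[OF christoffel_linear(1)] linear_cmul[OF christoffel_linear(2)]
  linear_0[OF christoffel_linear(1)] linear_0[OF christoffel_linear(2)]

lemma smooth_christoffel: "smooth_on U (\<lambda>y. christoffel G y u v)"
proof (rule smooth_on_cong[OF open_domain])
  have "smooth_on U (\<lambda>y. christoffel_lower y u v)"
    unfolding christoffel_lower_def divide_inverse mult.commute[of _ "inverse 2"] scaleR_scaleR[symmetric]
    by (intro smooth_on_sum smooth_on_scaleR smooth_on_add smooth_on_diff smooth_on_const
        open_domain smooth_on_dd smooth_metric)
  then show "smooth_on U (\<lambda>y. sharp G y (christoffel_lower y u v))" by (rule smooth_on_sharp)
qed (simp add: christoffel_eq_sharp)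

lemma differentiable_christoffel: "y \<in> U \<Longrightarrow> (\<lambda>y. christoffel G y u v) differentiable (at y)"
  using smooth_on_differentiable smooth_christoffel by blast

text \<open>Metric compatibility in coordinates: in the formulas for \<open>(u, v, w)\<close> and
  \<open>(u, w, v)\<close> the derivatives in the directions \<open>v\<close> and \<open>w\<close>
  cancel.\<close>

lemma dd_metric_eq_christoffel:
  "y \<in> U \<Longrightarrow> dd (\<lambda>y. G y v w) y u = G y (christoffel G y u v) w + G y v (christoffel G y u w)"
  by (simp add: metric_christoffel metric_sym[of y v] dd_metric_sym[of y w v] dd_metric_sym[of y u]
      field_simps)

lemma has_derivative_metric:
  assumes x: "(x has_derivative x') (at t)" and u: "(u has_derivative u') (at t)"
    and v: "(v has_derivative v') (at t)" and "x t \<in> U"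
  shows "((\<lambda>s. G (x s) (u s) (v s)) has_derivative (\<lambda>h.
      G (x t) (u' h + christoffel G (x t) (x' h) (u t)) (v t)
      + G (x t) (u t) (v' h + christoffel G (x t) (x' h) (v t)))) (at t)"
  using has_derivative_bilinear_family(2)[OF bilinear_metric open_domain differentiable_metric[OF assms(4)] x u v assms(4)]
  by (simp add: dd_metric_eq_christoffel assms(4) metric_linear_simps algebra_simps)

lemma has_derivative_christoffel:
  assumes x: "(x has_derivative x') (at t)" and u: "(u has_derivative u') (at t)"
    and v: "(v has_derivative v') (at t)" and "x t \<in> U"
  shows "((\<lambda>s. christoffel G (x s) (u s) (v s)) has_derivative (\<lambda>h.
      dd (\<lambda>y. christoffel G y (u t) (v t)) (x t) (x' h)
      + christoffel G (x t) (u t) (v' h) + christoffel G (x t) (u' h) (v t))) (at t)"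
  by (rule has_derivative_bilinear_family(2)[OF bilinear_christoffel open_domain
        differentiable_christoffel[OF assms(4)] x u v assms(4)])

lemma linear_dd_christoffel:
  assumes "y \<in> U"
  shows "linear (\<lambda>u. dd (\<lambda>y. christoffel G y u v) y a)"
    "linear (\<lambda>v. dd (\<lambda>y. christoffel G y u v) y a)" "linear (dd (\<lambda>y. christoffel G y u v) y)"
  using linear_dd_family[OF christoffel_linear(2) open_domain assms differentiable_christoffel[OF assms]]
    linear_dd_family[OF christoffel_linear(1) open_domain assms differentiable_christoffel[OF assms]]
    linear_dd[OF differentiable_christoffel[OF assms]] by blast+

lemmas dd_christoffel_simps =
  linear_add[OF linear_dd_christoffel(1)] linear_add[OF linear_dd_christoffel(2)]
  linear_add[OF linear_dd_christoffel(3)] linear_cmul[OF linear_dd_christoffel(1)]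
  linear_cmul[OF linear_dd_christoffel(2)] linear_cmul[OF linear_dd_christoffel(3)]

section \<open>Symmetries of the curvature tensor\<close>

lemma curvature_eq:
  assumes "y \<in> U"
  shows "curvature G y u v w =
    dd (\<lambda>y. christoffel G y v w) y u + christoffel G y u (christoffel G y v w)
    - dd (\<lambda>y. christoffel G y u w) y v - christoffel G y v (christoffel G y u w)"
  by (simp add: curvature_def nabla_def[abs_def] lie_bracket_def Let_def christoffel_linear_simps assms)

lemma curvature_linear:
  assumes "y \<in> U"
  shows "linear (\<lambda>u. curvature G y u v w)" "linear (\<lambda>v. curvature G y u v w)" "linear (curvature G y u v)"
  by (rule linearI; simp add: curvature_eq assms dd_christoffel_simps christoffel_linear_simps algebra_simps)+

lemmas curvature_linear_simps =
  linear_add[OF curvature_linear(1)] linear_add[OF curvature_linear(2)] linear_add[OF curvature_linear(3)]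
  linear_neg[OF curvature_linear(1)] linear_neg[OF curvature_linear(2)] linear_neg[OF curvature_linear(3)]
  linear_cmul[OF curvature_linear(1)] linear_cmul[OF curvature_linear(2)] linear_cmul[OF curvature_linear(3)]

lemma curvature_antisym: "y \<in> U \<Longrightarrow> curvature G y u v w = - curvature G y v u w"
  by (simp add: curvature_eq)

lemma dd_christoffel_sym: "y \<in> U \<Longrightarrow> dd (\<lambda>y. christoffel G y u v) y a = dd (\<lambda>y. christoffel G y v u) y a"
  by (rule dd_cong[OF open_domain]) (auto simp: christoffel_sym)

text \<open>Torsion-freeness makes the terms of the cyclic sum cancel in pairs.\<close>

lemma bianchi:
  assumes "y \<in> U"
  shows "curvature G y u v w + curvature G y v w u + curvature G y w u v = 0"
  using dd_christoffel_sym[OF assms, of u v w] dd_christoffel_sym[OF assms, of u w v]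
    dd_christoffel_sym[OF assms, of v w u] christoffel_sym[OF assms, of u v]
    christoffel_sym[OF assms, of u w] christoffel_sym[OF assms, of v w]
  by (simp add: curvature_eq[OF assms])

text \<open>Metricity of the connection, differentiated once more and antisymmetrized in the two
  directions of differentiation.\<close>

lemma metric_curvature_antisym:
  assumes y: "y \<in> U"
  shows "G y (curvature G y a u v) w = - G y v (curvature G y a u w)"
proof -
  let ?\<Gamma> = "christoffel G y"
  have K: "dd (\<lambda>y. dd (\<lambda>y. G y v w) y u) y a =
      G y (dd (\<lambda>y. christoffel G y u v) y a + ?\<Gamma> a (?\<Gamma> u v)) w + G y (?\<Gamma> u v) (?\<Gamma> a w)
      + G y (?\<Gamma> a v) (?\<Gamma> u w) + G y v (dd (\<lambda>y. christoffel G y u w) y a + ?\<Gamma> a (?\<Gamma> u w))"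
    for a u
  proof -
    have "dd (\<lambda>y. dd (\<lambda>y. G y v w) y u) y a
        = dd (\<lambda>y. G y (christoffel G y u v) w + G y v (christoffel G y u w)) y a"
      by (rule dd_cong[OF open_domain y]) (simp add: dd_metric_eq_christoffel)
    \<comment> \<open>The zeros are the derivatives of the constant arguments \<open>v\<close> and
      \<open>w\<close>; they match the form of \<open>has_derivative_metric\<close>.\<close>
    also have "\<dots> = G y (dd (\<lambda>y. christoffel G y u v) y a + ?\<Gamma> a (?\<Gamma> u v)) w + G y (?\<Gamma> u v) (0 + ?\<Gamma> a w)
        + (G y (0 + ?\<Gamma> a v) (?\<Gamma> u w) + G y v (dd (\<lambda>y. christoffel G y u w) y a + ?\<Gamma> a (?\<Gamma> u w)))"
      by (rule dd_eqI, rule has_derivative_add; rule has_derivative_metric)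
         (use y has_derivative_dd[OF differentiable_christoffel[OF y]] in auto)
    finally show ?thesis by simp
  qed
  from dd_commute[OF smooth_metric open_domain y, of v w u a] show ?thesis
    unfolding K curvature_eq[OF y] by (simp add: metric_linear_simps y)
qed

text \<open>Four Bianchi identities, from rotating the arguments cyclically, and antisymmetry within
  each pair form a linear system that implies the claim.\<close>

lemma curvature_pair_sym:
  assumes y: "y \<in> U"
  shows "G y (curvature G y a b c) d = G y (curvature G y c d a) b"
proof -
  let ?K = "\<lambda>a b c d. G y (curvature G y a b c) d"
  have B: "?K a b c d + ?K b c a d + ?K c a b d = 0" for a b c d
    using arg_cong[OF bianchi[OF y, of a b c], of "\<lambda>v. G y v d"] by (simp add: metric_linear_simps y)
  have A: "?K a b c d = - ?K b a c d" for a b c d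
    using curvature_antisym[OF y, of a b c] by (simp add: metric_linear_simps y)
  have S: "?K a b c d = - ?K a b d c" for a b c d
    using metric_curvature_antisym[OF y, of a b c d] metric_sym[OF y, of c] by simp
  show ?thesis
    using B[of a b c d] B[of b c d a] B[of c d a b] B[of d a b c]
      A[of a b c d] A[of b c a d] A[of c a b d] A[of b c d a] A[of c d b a] A[of d b c a]
      A[of c d a b] A[of d a c b] A[of a c d b] A[of d a b c] A[of a b d c] A[of b d a c]
      S[of a b c d] S[of b c a d] S[of c a b d] S[of c d b a] S[of d b c a] S[of d a c b] S[of a c d b]
      S[of a b d c] S[of b d a c] S[of c d a b] S[of d a b c] S[of b c d a]
    by linarith
qed

end

section \<open>Covariant derivatives along a curve\<close>

context metric_domain
begin

lemma metric_along:
  assumes "(x has_vector_derivative X) (at t)" "(u has_vector_derivative u') (at t)"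
    "(v has_vector_derivative v') (at t)" "x t \<in> U"
  shows "((\<lambda>s. G (x s) (u s) (v s)) has_vector_derivative
    G (x t) (u' + christoffel G (x t) X (u t)) (v t)
    + G (x t) (u t) (v' + christoffel G (x t) X (v t))) (at t)"
  using has_derivative_metric[OF assms[unfolded has_vector_derivative_def]]
  unfolding has_vector_derivative_def
  by (rule has_derivative_eq_rhs)
     (simp add: fun_eq_iff metric_linear_simps christoffel_linear_simps assms(4) algebra_simps)

lemma smooth_curvature: "smooth_on U (\<lambda>y. curvature G y u v w)"
proof (rule smooth_on_cong[OF open_domain])
  let ?\<Gamma> = "christoffel G"
  \<comment> \<open>The inner Christoffel vector is expanded in the basis because smoothness of
    \<open>christoffel\<close> is available for constant arguments.\<close>
  show "smooth_on U (\<lambda>y. dd (\<lambda>y. ?\<Gamma> y v w) y u + (\<Sum>i\<in>Basis. (?\<Gamma> y v w \<bullet> i) *\<^sub>R ?\<Gamma> y u i)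
      - dd (\<lambda>y. ?\<Gamma> y u w) y v - (\<Sum>i\<in>Basis. (?\<Gamma> y u w \<bullet> i) *\<^sub>R ?\<Gamma> y v i))"
    by (intro smooth_on_diff smooth_on_add smooth_on_sum smooth_on_scaleR smooth_on_dd
        smooth_christoffel open_domain
        smooth_on_bounded_linear[OF open_domain bounded_linear_inner_left])
qed (simp add: curvature_eq linear_expand[OF christoffel_linear(1), symmetric])

lemma differentiable_curvature: "y \<in> U \<Longrightarrow> (\<lambda>y. curvature G y u v w) differentiable (at y)"
  using smooth_on_differentiable smooth_curvature by blast

text \<open>This is the Leibniz rule for a parallel tensor, solved for the ordinary derivative. The
  components of \<open>u\<close> are constant, so its covariant derivative is the Christoffel term
  alone.\<close>

lemma curvature_along:
  assumes "(x has_vector_derivative X) (at t)" "(a has_vector_derivative a') (at t)"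
    "(b has_vector_derivative b') (at t)" "x t \<in> U"
    and parallel: "nabla_curvature G (x t) X (a t) (b t) u = 0"
  shows "((\<lambda>s. curvature G (x s) (a s) (b s) u) has_vector_derivative
    curvature G (x t) (a' + christoffel G (x t) X (a t)) (b t) u
    + curvature G (x t) (a t) (b' + christoffel G (x t) X (b t)) u
    + curvature G (x t) (a t) (b t) (christoffel G (x t) X u)
    - christoffel G (x t) X (curvature G (x t) (a t) (b t) u)) (at t)"
proof -
  have bil: "y \<in> U \<Longrightarrow> bilinear (\<lambda>a b. curvature G y a b u)" for y
    using curvature_linear by (simp add: bilinear_def)
  have l: "linear (dd (\<lambda>y. curvature G y (a t) (b t) u) (x t))"
    by (rule linear_dd[OF differentiable_curvature[OF assms(4)]])
  have p: "dd (\<lambda>y. curvature G y (a t) (b t) u) (x t) X =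
      curvature G (x t) (christoffel G (x t) X (a t)) (b t) u
      + curvature G (x t) (a t) (christoffel G (x t) X (b t)) u
      + curvature G (x t) (a t) (b t) (christoffel G (x t) X u)
      - christoffel G (x t) X (curvature G (x t) (a t) (b t) u)"
    using parallel by (simp add: nabla_curvature_def nabla_def Let_def algebra_simps)
  show ?thesis
    unfolding has_vector_derivative_def
    by (rule has_derivative_eq_rhs[OF has_derivative_bilinear_family(2)[OF bil open_domain
          differentiable_curvature[OF assms(4)] assms(1-3)[unfolded has_vector_derivative_def] assms(4)]])
       (simp_all add: fun_eq_iff linear_cmul[OF l] p curvature_linear_simps assms(4) algebra_simps)
qed

text \<open>Only existence is recorded. The derivative of \<open>v\<close> is identified later by
  differentiating a pairing, and that of \<open>w\<close> by the geodesic equation.\<close>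

lemma sharp_along:
  assumes "(x has_vector_derivative X) (at t)" "(f has_vector_derivative f') (at t)" "x t \<in> U"
  obtains v' where "((\<lambda>s. sharp G (x s) (f s)) has_vector_derivative v') (at t)"
  using has_derivative_sharp[OF assms(1,2)[unfolded has_vector_derivative_def] assms(3)]
    differentiableI vector_derivative_works by blast

end

section \<open>Curvature identities for a parallel complex structure\<close>

locale kaehler_domain = metric_domain U G
  for U :: "'e::euclidean_space set" and G +
  fixes J :: "'e \<Rightarrow> 'e \<Rightarrow> 'e"
  assumes linear_J: "y \<in> U \<Longrightarrow> linear (J y)"
    and J_J: "y \<in> U \<Longrightarrow> J y (J y u) = - u"
    and smooth_J: "smooth_on U (\<lambda>y. J y u)"
    and metric_J_J: "y \<in> U \<Longrightarrow> G y (J y u) (J y v) = G y u v"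
    and parallel_J: "y \<in> U \<Longrightarrow> nabla_endo G J y z u = 0"
begin

lemmas J_linear_simps = linear_add[OF linear_J] linear_diff[OF linear_J] linear_neg[OF linear_J]
  linear_cmul[OF linear_J]

lemma metric_J: "y \<in> U \<Longrightarrow> G y (J y u) v = - G y u (J y v)"
  using metric_J_J[of y "J y u" v] by (simp add: J_J metric_linear_simps)

lemma differentiable_J: "y \<in> U \<Longrightarrow> (\<lambda>y. J y u) differentiable (at y)"
  using smooth_on_differentiable smooth_J by blast

lemma dd_J:
  "y \<in> U \<Longrightarrow> dd (\<lambda>y. J y u) y z = J y (christoffel G y z u) - christoffel G y z (J y u)"
  using parallel_J[of y z u] by (simp add: nabla_endo_def nabla_def algebra_simps)

lemma has_derivative_J:
  assumes x: "(x has_derivative x') (at t)" and v: "(v has_derivative v') (at t)" and "x t \<in> U"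
  shows "((\<lambda>s. J (x s) (v s)) has_derivative (\<lambda>h.
      J (x t) (v' h + christoffel G (x t) (x' h) (v t)) - christoffel G (x t) (x' h) (J (x t) (v t)))) (at t)"
  using has_derivative_linear_family(2)[OF linear_J open_domain differentiable_J[OF assms(3)] x v assms(3)]
  by (simp add: dd_J assms(3) J_linear_simps algebra_simps)

lemma J_along:
  assumes "(x has_vector_derivative X) (at t)" "(v has_vector_derivative v') (at t)" "x t \<in> U"
  shows "((\<lambda>s. J (x s) (v s)) has_vector_derivative
    J (x t) (v' + christoffel G (x t) X (v t)) - christoffel G (x t) X (J (x t) (v t))) (at t)"
  using has_derivative_J[OF assms[unfolded has_vector_derivative_def]]
  unfolding has_vector_derivative_def
  by (rule has_derivative_eq_rhs)
     (simp add: fun_eq_iff J_linear_simps christoffel_linear_simps assms(3) algebra_simps)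

text \<open>Integrability condition of \<open>\<nabla>J = 0\<close>: differentiating
  \<open>dd_J\<close> once more expresses the second derivatives of \<open>J\<close> through
  Christoffel symbols, and their symmetry in \<open>z\<close> and \<open>a\<close> leaves exactly
  the commutator of \<open>J\<close> with the curvature.\<close>

lemma curvature_J_commute:
  assumes y: "y \<in> U"
  shows "curvature G y a z (J y u) = J y (curvature G y a z u)"
proof -
  let ?\<Gamma> = "christoffel G y"
  have K: "dd (\<lambda>y. dd (\<lambda>y. J y u) y z) y a =
      J y (dd (\<lambda>y. christoffel G y z u) y a + ?\<Gamma> a (?\<Gamma> z u)) - ?\<Gamma> a (J y (?\<Gamma> z u))
      - (dd (\<lambda>w. christoffel G w z (J y u)) y a + ?\<Gamma> z (J y (?\<Gamma> a u) - ?\<Gamma> a (J y u)))" for z a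
  proof -
    have "dd (\<lambda>y. dd (\<lambda>y. J y u) y z) y a
        = dd (\<lambda>y. J y (christoffel G y z u) - christoffel G y z (J y u)) y a"
      by (rule dd_cong[OF open_domain y]) (simp add: dd_J)
    \<comment> \<open>The zeros are the derivatives of the constant arguments \<open>u\<close> and
      \<open>z\<close>.\<close>
    also have "\<dots> = J y (dd (\<lambda>y. christoffel G y z u) y a + ?\<Gamma> a (?\<Gamma> z u)) - ?\<Gamma> a (J y (?\<Gamma> z u))
      - (dd (\<lambda>w. christoffel G w z (J y u)) y a + ?\<Gamma> z (J y (0 + ?\<Gamma> a u) - ?\<Gamma> a (J y u)) + ?\<Gamma> 0 (J y u))"
      by (rule dd_eqI, rule has_derivative_diff; (rule has_derivative_J has_derivative_christoffel)?)
         (use y has_derivative_dd[OF differentiable_christoffel[OF y]]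
            has_derivative_J[of "\<lambda>y. y" "\<lambda>a. a" y "\<lambda>_. u" "\<lambda>_. 0"] in auto)
    finally show ?thesis by (simp add: christoffel_linear_simps y)
  qed
  from dd_commute[OF smooth_J open_domain y, of u z a] show ?thesis
    unfolding K curvature_eq[OF y] by (simp add: J_linear_simps christoffel_linear_simps y algebra_simps)
qed

text \<open>Pair symmetry moves the two \<open>J\<close> from the first pair to the argument of the
  endomorphism and to the metric, where commutation and invariance of \<open>G\<close> remove
  them.\<close>

lemma curvature_J_J:
  assumes y: "y \<in> U"
  shows "curvature G y (J y u) (J y v) w = curvature G y u v w"
proof (rule metric_eqI[OF y])
  fix z
  have "G y (curvature G y (J y u) (J y v) w) z = G y (curvature G y w z (J y u)) (J y v)"
    by (rule curvature_pair_sym[OF y])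
  also have "\<dots> = G y (curvature G y w z u) v" by (simp add: curvature_J_commute metric_J_J y)
  also have "\<dots> = G y (curvature G y u v w) z" by (rule curvature_pair_sym[OF y])
  finally show "G y (curvature G y (J y u) (J y v) w) z = G y (curvature G y u v w) z" .
qed

lemma sharp_covec_comp: "y \<in> U \<Longrightarrow> sharp G y (covec_comp p (J y)) = - J y (sharp G y p)"
proof (rule sharp_eqI)
  fix u assume y: "y \<in> U"
  have "linear (\<lambda>u. p \<bullet> J y u)"
    by (rule linearI) (auto simp: J_linear_simps y inner_add_right)
  from linear_expand[OF this, of u] have "covec_comp p (J y) \<bullet> u = p \<bullet> J y u"
    unfolding covec_comp_def inner_sum_left inner_scaleR_left
    by (simp add: inner_commute mult.commute)
  then show "G y (- J y (sharp G y p)) u = covec_comp p (J y) \<bullet> u"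
    by (simp add: metric_linear_simps metric_J metric_sharp y)
qed simp

end

section \<open>Geodesics of the Berger-type deformed Sasaki metric\<close>

context metric_domain
begin

text \<open>The fibre component of the horizontal lift of \<open>X\<close> at \<open>(y, p)\<close>.
  Hence \<open>P - christoffel_form y p X\<close> is the vertical part of \<open>(X, P)\<close>, and
  along a curve it is the covariant derivative of the covector field.\<close>

definition christoffel_form :: "'e \<Rightarrow> 'e \<Rightarrow> 'e \<Rightarrow> 'e" where
  "christoffel_form y p X = (\<Sum>i\<in>Basis. (p \<bullet> christoffel G y i X) *\<^sub>R i)"

lemma christoffel_form_inner:
  assumes "y \<in> U"
  shows "christoffel_form y p X \<bullet> u = p \<bullet> christoffel G y u X"
proof -
  have "linear (\<lambda>u. p \<bullet> christoffel G y u X)"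
    by (rule linearI) (auto simp: christoffel_linear_simps assms inner_add_right)
  from linear_expand[OF this, of u] show ?thesis
    unfolding christoffel_form_def inner_sum_left inner_scaleR_left
    by (simp add: inner_commute mult.commute)
qed

lemma christoffel_form_add_scaleR:
  "christoffel_form y (p + r *\<^sub>R q) X = christoffel_form y p X + r *\<^sub>R christoffel_form y q X"
  by (simp add: christoffel_form_def inner_add_left scaleR_add_left sum.distrib scaleR_sum_right)

text \<open>Raising an index commutes with covariant differentiation because the metric is parallel:
  the pairing of \<open>sharp G (x s) (p s)\<close> with a constant \<open>u\<close> is
  differentiated once through the metric and once as \<open>p s \<bullet> u\<close>.\<close>

lemma sharp_covariant_along:
  assumes T: "open T" "t \<in> T" "\<And>s. s \<in> T \<Longrightarrow> x s \<in> U"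
    and x: "(x has_vector_derivative X) (at t)" and p: "(p has_vector_derivative P) (at t)"
  shows "((\<lambda>s. sharp G (x s) (p s)) has_vector_derivative
    sharp G (x t) (P - christoffel_form (x t) (p t) X)
    - christoffel G (x t) X (sharp G (x t) (p t))) (at t)"
proof -
  have y: "x t \<in> U" using T by blast
  obtain v' where v': "((\<lambda>s. sharp G (x s) (p s)) has_vector_derivative v') (at t)"
    using sharp_along[OF x p y] by blast
  let ?v = "sharp G (x t) (p t)"
  have "sharp G (x t) (P - christoffel_form (x t) (p t) X) = v' + christoffel G (x t) X ?v"
  proof (rule sharp_eqI[OF y])
    fix u
    have "((\<lambda>s. p s \<bullet> u) has_vector_derivative P \<bullet> u) (at t)"
      by (rule bounded_linear.has_vector_derivative[OF bounded_linear_inner_left p])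
    then have "((\<lambda>s. G (x s) (sharp G (x s) (p s)) u) has_vector_derivative P \<bullet> u) (at t)"
      by (rule has_vector_derivative_transform_within_open[OF _ T(1,2)]) (simp add: metric_sharp T(3))
    from vector_derivative_unique_at[OF this metric_along[OF x v' has_vector_derivative_const y]]
    show "G (x t) (v' + christoffel G (x t) X ?v) u = (P - christoffel_form (x t) (p t) X) \<bullet> u"
      by (simp add: inner_diff_left christoffel_form_inner y metric_sharp christoffel_sym[of _ X])
  qed
  then show ?thesis using v' by simp
qed

lemma christoffel_form_along:
  assumes x: "(x has_vector_derivative x') (at t)" and p: "(p has_vector_derivative p') (at t)"
    and X: "(X has_vector_derivative X') (at t)" and y: "x t \<in> U"
  obtains d where "((\<lambda>s. christoffel_form (x s) (p s) (X s)) has_vector_derivative d) (at t)"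
proof -
  have "(\<lambda>s. christoffel_form (x s) (p s) (X s)) differentiable (at t)"
    unfolding christoffel_form_def
    by (intro differentiable_sum differentiable_scaleR differentiable_inner differentiable_const
        differentiableI[OF p[unfolded has_vector_derivative_def]]
        differentiableI[OF has_derivative_christoffel[OF x[unfolded has_vector_derivative_def]
            has_derivative_const X[unfolded has_vector_derivative_def] y]] finite_Basis ballI)
  then show ?thesis using that vector_derivative_works by blast
qed

end

section \<open>The Berger-type metric in an induced chart\<close>

locale berger_domain = kaehler_domain U G J + cotangent: metric_domain "U \<times> UNIV" H
  for U :: "'e::euclidean_space set" and G J and H :: "'e \<times> 'e \<Rightarrow> 'e \<times> 'e \<Rightarrow> 'e \<times> 'e \<Rightarrow> real" +
  fixes \<delta> :: real
  assumes horizontal_horizontal: "y \<in> U \<Longrightarrow>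
      H (y, p) (horizontal_lift G y p X) (horizontal_lift G y p Y) = G y X Y"
    and horizontal_vertical: "y \<in> U \<Longrightarrow> H (y, p) (horizontal_lift G y p X) (vertical_lift \<omega>) = 0"
    and vertical_vertical: "y \<in> U \<Longrightarrow> H (y, p) (vertical_lift \<omega>) (vertical_lift \<eta>) =
      ginv G y \<omega> \<eta> + \<delta>\<^sup>2 * ginv G y \<omega> (covec_comp p (J y)) * ginv G y \<eta> (covec_comp p (J y))"
begin

lemma lift_decomposition:
  "(X, P) = horizontal_lift G y p X + vertical_lift (P - christoffel_form y p X)"
  by (simp add: horizontal_lift_def vertical_lift_def christoffel_form_def)

text \<open>This is the fibre momentum: only the vertical part of \<open>(X, P)\<close> contributes,
  and the two minus signs from the dual vector \<open>-Jv\<close> cancel.\<close>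

lemma metric_vertical:
  assumes y: "y \<in> U" and w: "w = sharp G y (P - christoffel_form y p X)" and v: "v = sharp G y p"
  shows "H (y, p) (X, P) (0, \<omega>) = \<omega> \<bullet> (w + (\<delta>\<^sup>2 * G y w (J y v)) *\<^sub>R J y v)"
proof -
  have yp: "(y, p) \<in> U \<times> UNIV" using y by simp
  have "H (y, p) (X, P) (0, \<omega>)
      = H (y, p) (vertical_lift (P - christoffel_form y p X)) (vertical_lift \<omega>)"
    unfolding lift_decomposition[of X P y p] vertical_lift_def[of \<omega>, symmetric]
    by (simp add: cotangent.metric_linear_simps yp horizontal_vertical y)
  also have "\<dots> = G y w (sharp G y \<omega>) + \<delta>\<^sup>2 * G y w (J y v) * G y (sharp G y \<omega>) (J y v)"
    by (simp add: vertical_vertical y ginv_def sharp_covec_comp metric_linear_simps w v)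
  finally show ?thesis
    by (simp add: metric_sharp metric_sym[OF y, of w "sharp G y \<omega>"] y inner_add_right)
qed

lemma metric_diagonal:
  assumes y: "y \<in> U" and w: "w = sharp G y (P - christoffel_form y p X)" and v: "v = sharp G y p"
  shows "H (y, p) (X, P) (X, P) = G y X X + G y w w + \<delta>\<^sup>2 * (G y w (J y v))\<^sup>2"
proof -
  have yp: "(y, p) \<in> U \<times> UNIV" using y by simp
  have hv: "H (y, p) (vertical_lift \<omega>) (horizontal_lift G y p X) = 0" for \<omega>
    using horizontal_vertical[OF y] cotangent.metric_sym[OF yp] by metis
  show ?thesis
    unfolding lift_decomposition[of X P y p]
    by (simp add: cotangent.metric_linear_simps yp horizontal_vertical hv horizontal_horizontal
        vertical_vertical y ginv_def sharp_covec_comp metric_linear_simps w v power2_eq_square)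
qed

text \<open>With \<open>X\<close> and \<open>P\<close> fixed, moving \<open>p\<close> to
  \<open>p + r \<omega>\<close> changes \<open>w\<close> by \<open>-r ?k\<close> and
  \<open>v\<close> by \<open>r ?q\<close>. Along this line the squared norm from
  \<open>metric_diagonal\<close> is a polynomial in \<open>r\<close>, and the derivative is its
  linear coefficient.\<close>

lemma dd_metric_diagonal:
  assumes y: "y \<in> U" and w: "w = sharp G y (P - christoffel_form y p X)" and v: "v = sharp G y p"
    and \<beta>: "\<beta> = G y w (J y v)"
  shows "dd (\<lambda>z. H z (X, P) (X, P)) (y, p) (0, \<omega>) =
    - 2 * (\<omega> \<bullet> (christoffel G y X w + (\<delta>\<^sup>2 * \<beta>) *\<^sub>R christoffel G y X (J y v) + (\<delta>\<^sup>2 * \<beta>) *\<^sub>R J y w))"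
proof -
  let ?q = "sharp G y \<omega>" and ?k = "sharp G y (christoffel_form y \<omega> X)"
  have line: "((\<lambda>r. (y, p + r *\<^sub>R \<omega>)) has_derivative (\<lambda>r. (0, r *\<^sub>R \<omega>))) (at (0::real))"
    by (auto intro!: derivative_eq_intros)
  have dH: "(\<lambda>z. H z (X, P) (X, P)) differentiable (at (y, p + 0 *\<^sub>R \<omega>))"
    using cotangent.differentiable_metric[of "(y, p)"] y by simp
  have "((\<lambda>r. H (y, p + r *\<^sub>R \<omega>) (X, P) (X, P)) has_derivative
      (\<lambda>r. dd (\<lambda>z. H z (X, P) (X, P)) (y, p) (0, r *\<^sub>R \<omega>))) (at 0)"
    using has_derivative_compose[OF line has_derivative_dd[OF dH]] by simp
  then have 1: "((\<lambda>r. H (y, p + r *\<^sub>R \<omega>) (X, P) (X, P)) has_vector_derivative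
      dd (\<lambda>z. H z (X, P) (X, P)) (y, p) (0, \<omega>)) (at 0)"
    unfolding has_vector_derivative_def
    by (rule has_derivative_eq_rhs)
       (use linear_cmul[OF cotangent.linear_dd_metric(3)[of "(y, p)" "(X, P)" "(X, P)"], of _ "(0, \<omega>)"] y
         in \<open>simp add: fun_eq_iff\<close>)
  have "H (y, p + r *\<^sub>R \<omega>) (X, P) (X, P) =
      G y X X + (G y w w - 2 * r * G y ?k w + r\<^sup>2 * G y ?k ?k)
      + \<delta>\<^sup>2 * (\<beta> + r * (G y w (J y ?q) - G y ?k (J y v)) - r\<^sup>2 * G y ?k (J y ?q))\<^sup>2" for r
  proof -
    have "sharp G y (P - christoffel_form y (p + r *\<^sub>R \<omega>) X) = w - r *\<^sub>R ?k"
      by (simp add: w christoffel_form_add_scaleR linear_diff[OF linear_sharp[OF y]]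
          linear_add[OF linear_sharp[OF y]] linear_cmul[OF linear_sharp[OF y]])
    moreover have "sharp G y (p + r *\<^sub>R \<omega>) = v + r *\<^sub>R ?q"
      by (simp add: v linear_add[OF linear_sharp[OF y]] linear_cmul[OF linear_sharp[OF y]])
    ultimately have "H (y, p + r *\<^sub>R \<omega>) (X, P) (X, P) =
        G y X X + G y (w - r *\<^sub>R ?k) (w - r *\<^sub>R ?k) + \<delta>\<^sup>2 * (G y (w - r *\<^sub>R ?k) (J y (v + r *\<^sub>R ?q)))\<^sup>2"
      using metric_diagonal[OF y refl refl] by simp
    moreover have "G y (w - r *\<^sub>R ?k) (w - r *\<^sub>R ?k) = G y w w - 2 * r * G y ?k w + r\<^sup>2 * G y ?k ?k"
      by (simp add: metric_linear_simps y metric_sym[OF y, of w ?k] power2_eq_square algebra_simps)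
    moreover have "G y (w - r *\<^sub>R ?k) (J y (v + r *\<^sub>R ?q))
        = \<beta> + r * (G y w (J y ?q) - G y ?k (J y v)) - r\<^sup>2 * G y ?k (J y ?q)"
      by (simp add: metric_linear_simps J_linear_simps y \<beta> power2_eq_square algebra_simps)
    ultimately show ?thesis by simp
  qed
  moreover have "((\<lambda>r. G y X X + (G y w w - 2 * r * G y ?k w + r\<^sup>2 * G y ?k ?k)
      + \<delta>\<^sup>2 * (\<beta> + r * (G y w (J y ?q) - G y ?k (J y v)) - r\<^sup>2 * G y ?k (J y ?q))\<^sup>2)
      has_real_derivative - 2 * G y ?k w + \<delta>\<^sup>2 * (2 * \<beta> * (G y w (J y ?q) - G y ?k (J y v)))) (at 0)"
    by (auto intro!: derivative_eq_intros)
  ultimately have 2: "((\<lambda>r. H (y, p + r *\<^sub>R \<omega>) (X, P) (X, P)) has_vector_derivative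
      - 2 * G y ?k w + \<delta>\<^sup>2 * (2 * \<beta> * (G y w (J y ?q) - G y ?k (J y v)))) (at 0)"
    by (simp add: has_real_derivative_iff_has_vector_derivative)
  have k: "G y ?k u = \<omega> \<bullet> christoffel G y X u" for u
    by (simp add: metric_sharp christoffel_form_inner y christoffel_sym[OF y, of X])
  \<comment> \<open>Skewness of \<open>J\<close> turns the variation of the fibre metric into a
    multiple of \<open>Jw\<close>.\<close>
  have q: "G y w (J y ?q) = - \<omega> \<bullet> J y w"
    using metric_J[OF y, of w ?q] metric_sym[OF y, of "J y w"] metric_sharp[OF y] by simp
  from vector_derivative_unique_at[OF 1 2] show ?thesis
    unfolding k q by (simp add: inner_add_right algebra_simps)
qed

end

section \<open>The vertical geodesic equation and its consequence for curvature\<close>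

context berger_domain
begin

text \<open>The geodesic equation paired with the constant vertical field \<open>(0, \<omega>)\<close>; the Christoffel
  terms in the derivative of the fibre metric cancel those from \<open>dd_metric_diagonal\<close>.\<close>

lemma vertical_geodesic_equation:
  fixes x p X P :: "real \<Rightarrow> 'e"
  assumes T: "open T" "t \<in> T" "\<And>s. s \<in> T \<Longrightarrow> x s \<in> U"
    and x: "\<And>s. s \<in> T \<Longrightarrow> (x has_vector_derivative X s) (at s)"
    and p: "\<And>s. s \<in> T \<Longrightarrow> (p has_vector_derivative P s) (at s)"
    and X: "(X has_vector_derivative X') (at t)" and P: "(P has_vector_derivative P') (at t)"
    and geodesic: "(X', P') + christoffel H (x t, p t) (X t, P t) (X t, P t) = 0"
    and w: "w = (\<lambda>s. sharp G (x s) (P s - christoffel_form (x s) (p s) (X s)))"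
    and v: "v = (\<lambda>s. sharp G (x s) (p s))" and \<beta>: "\<beta> = (\<lambda>s. G (x s) (w s) (J (x s) (v s)))"
  obtains w' \<beta>' where "(w has_vector_derivative w') (at t)"
    and "(\<beta> has_vector_derivative \<beta>') (at t)"
    and "(v has_vector_derivative w t - christoffel G (x t) (X t) (v t)) (at t)"
    and "w' + christoffel G (x t) (X t) (w t)
      = - (\<delta>\<^sup>2) *\<^sub>R (\<beta>' *\<^sub>R J (x t) (v t) + (2 * \<beta> t) *\<^sub>R J (x t) (w t))"
proof -
  note y = T(3)[OF T(2)] and xt = x[OF T(2)] and pt = p[OF T(2)]
  let ?\<Gamma> = "christoffel G (x t) (X t)" and ?J = "J (x t)"
  have v': "(v has_vector_derivative w t - ?\<Gamma> (v t)) (at t)"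
    unfolding v w using sharp_covariant_along[OF T xt pt] .
  obtain d where "((\<lambda>s. christoffel_form (x s) (p s) (X s)) has_vector_derivative d) (at t)"
    using christoffel_form_along[OF xt pt X y] by blast
  from sharp_along[OF xt has_vector_derivative_diff[OF P this] y]
  obtain w' where w': "(w has_vector_derivative w') (at t)" unfolding w by blast
  have Jv: "((\<lambda>s. J (x s) (v s)) has_vector_derivative ?J (w t) - ?\<Gamma> (?J (v t))) (at t)"
    using J_along[OF xt v' y] by simp
  obtain \<beta>' where \<beta>': "(\<beta> has_vector_derivative \<beta>') (at t)"
    using metric_along[OF xt w' Jv y] unfolding \<beta> by blast
  have z: "((\<lambda>s. (x s, p s)) has_vector_derivative (X t, P t)) (at t)"
    using xt pt by (rule has_vector_derivative_Pair)
  have u: "((\<lambda>s. (X s, P s)) has_vector_derivative (X', P')) (at t)"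
    using X P by (rule has_vector_derivative_Pair)
  have yp: "(x t, p t) \<in> U \<times> UNIV" using y by simp
  have "\<omega> \<bullet> (w' + ?\<Gamma> (w t) + \<delta>\<^sup>2 *\<^sub>R (\<beta>' *\<^sub>R ?J (v t) + (2 * \<beta> t) *\<^sub>R ?J (w t))) = 0" for \<omega>
  proof -
    let ?F = "\<lambda>s. H (x s, p s) (X s, P s) (0, \<omega>)"
    \<comment> \<open>Metric compatibility of \<open>H\<close>: the geodesic equation removes the
      acceleration, and the constant field \<open>(0, \<omega>)\<close> contributes only its
      Christoffel term.\<close>
    have "(?F has_vector_derivative
        H (x t, p t) (X t, P t) (christoffel H (x t, p t) (X t, P t) (0, \<omega>))) (at t)"
      using cotangent.metric_along[OF z u has_vector_derivative_const[of "(0, \<omega>)"] yp] geodesic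
      by (simp add: cotangent.metric_linear_simps y)
    \<comment> \<open>By symmetry the direction of differentiation can be taken to be
      \<open>(0, \<omega>)\<close>, and compatibility then gives twice this pairing as the
      derivative of the squared norm.\<close>
    also have "H (x t, p t) (X t, P t) (christoffel H (x t, p t) (X t, P t) (0, \<omega>))
        = dd (\<lambda>z. H z (X t, P t) (X t, P t)) (x t, p t) (0, \<omega>) / 2"
      using cotangent.dd_metric_eq_christoffel[OF yp, of "(X t, P t)" "(X t, P t)" "(0, \<omega>)"]
      by (simp add: cotangent.metric_sym[OF yp, of "(X t, P t)"] cotangent.christoffel_sym[OF yp, of "(X t, P t)"])
    also have "\<dots> = - (\<omega> \<bullet> (?\<Gamma> (w t) + (\<delta>\<^sup>2 * \<beta> t) *\<^sub>R ?\<Gamma> (?J (v t)) + (\<delta>\<^sup>2 * \<beta> t) *\<^sub>R ?J (w t)))"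
      using dd_metric_diagonal[OF y, of "w t" "P t" "p t" "X t" "v t" "\<beta> t" \<omega>] by (simp add: w v \<beta>)
    finally have 1: "(?F has_vector_derivative
        - (\<omega> \<bullet> (?\<Gamma> (w t) + (\<delta>\<^sup>2 * \<beta> t) *\<^sub>R ?\<Gamma> (?J (v t)) + (\<delta>\<^sup>2 * \<beta> t) *\<^sub>R ?J (w t)))) (at t)" .
    \<comment> \<open>The same pairing differentiated through the formula of
      \<open>metric_vertical\<close>. The \<open>Jw\<close> arising here and the one from
      \<open>dd_metric_diagonal\<close> add up to the coefficient
      \<open>2 * \<beta> t\<close>.\<close>
    have "((\<lambda>s. \<omega> \<bullet> (w s + (\<delta>\<^sup>2 * \<beta> s) *\<^sub>R J (x s) (v s))) has_vector_derivative
        \<omega> \<bullet> (w' + ((\<delta>\<^sup>2 * \<beta> t) *\<^sub>R (?J (w t) - ?\<Gamma> (?J (v t))) + (\<delta>\<^sup>2 * \<beta>') *\<^sub>R ?J (v t)))) (at t)"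
      using \<beta>' by (intro bounded_linear.has_vector_derivative[OF bounded_linear_inner_right]
          has_vector_derivative_add has_vector_derivative_scaleR w' Jv)
        (auto simp: has_real_derivative_iff_has_vector_derivative intro: has_vector_derivative_mult_right)
    then have 2: "(?F has_vector_derivative
        \<omega> \<bullet> (w' + ((\<delta>\<^sup>2 * \<beta> t) *\<^sub>R (?J (w t) - ?\<Gamma> (?J (v t))) + (\<delta>\<^sup>2 * \<beta>') *\<^sub>R ?J (v t)))) (at t)"
      by (rule has_vector_derivative_transform_within_open[OF _ T(1,2)])
         (simp add: metric_vertical[OF T(3) refl refl] w v \<beta>)
    from vector_derivative_unique_at[OF 1 2] show ?thesis
      by (simp add: inner_add_right inner_diff_right algebra_simps)
  qed
  then have "w' + ?\<Gamma> (w t) + \<delta>\<^sup>2 *\<^sub>R (\<beta>' *\<^sub>R ?J (v t) + (2 * \<beta> t) *\<^sub>R ?J (w t)) = 0"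
    using inner_eq_zero_iff by blast
  then have "w' + ?\<Gamma> (w t) = - (\<delta>\<^sup>2) *\<^sub>R (\<beta>' *\<^sub>R ?J (v t) + (2 * \<beta> t) *\<^sub>R ?J (w t))"
    by (simp add: add_eq_0_iff2)
  then show thesis using that w' \<beta>' v' by blast
qed

text \<open>The result inside one chart. \<open>E\<close> enters through an equation on
  \<open>T\<close> with \<open>ginv\<close> and \<open>covec_comp\<close> left in place, so that
  \<open>berger_curvature_along\<close> fits by unfolding.\<close>

lemma berger_curvature_parallel:
  fixes x p X P :: "real \<Rightarrow> 'e"
  assumes T: "open T" "t \<in> T" "\<And>s. s \<in> T \<Longrightarrow> x s \<in> U"
    and x: "\<And>s. s \<in> T \<Longrightarrow> (x has_vector_derivative X s) (at s)"
    and p: "\<And>s. s \<in> T \<Longrightarrow> (p has_vector_derivative P s) (at s)"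
    and X: "(X has_vector_derivative X') (at t)" and P: "(P has_vector_derivative P') (at t)"
    and geodesic: "(X', P') + christoffel H (x t, p t) (X t, P t) (X t, P t) = 0"
    and symmetric: "\<And>z a b c. nabla_curvature G (x t) z a b c = 0"
    and \<eta>: "\<eta> = (\<lambda>s. P s - christoffel_form (x s) (p s) (X s))"
    and w: "w = (\<lambda>s. sharp G (x s) (\<eta> s))" and v: "v = (\<lambda>s. sharp G (x s) (p s))"
    and E: "\<And>s. s \<in> T \<Longrightarrow> E s = (\<lambda>u. curvature G (x s) (w s) (v s) u
      + (\<delta>\<^sup>2 * ginv G (x s) (\<eta> s) (covec_comp (p s) (J (x s)))) *\<^sub>R curvature G (x s) (v s) (J (x s) (v s)) u)"
  shows "\<exists>E'. ((\<lambda>s. E s u) has_vector_derivative E') (at t) \<and>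
    E' + christoffel G (x t) (X t) (E t u) - E t (christoffel G (x t) (X t) u) = 0"
proof -
  define \<beta> where "\<beta> = (\<lambda>s. G (x s) (w s) (J (x s) (v s)))"
  note y = T(3)[OF T(2)] and xt = x[OF T(2)]
  let ?\<Gamma> = "christoffel G (x t) (X t)" and ?J = "J (x t)" and ?R = "curvature G (x t)"
  have E_eq: "E s u = curvature G (x s) (w s) (v s) u
      - (\<delta>\<^sup>2 * \<beta> s) *\<^sub>R curvature G (x s) (v s) (J (x s) (v s)) u" if "s \<in> T" for s u
    using E[OF that] T(3)[OF that]
    by (simp add: \<beta>_def ginv_def sharp_covec_comp w v metric_linear_simps)
  obtain w' \<beta>' where w': "(w has_vector_derivative w') (at t)"
    and \<beta>': "(\<beta> has_vector_derivative \<beta>') (at t)"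
    and v': "(v has_vector_derivative w t - ?\<Gamma> (v t)) (at t)"
    and eq: "w' + ?\<Gamma> (w t) = - (\<delta>\<^sup>2) *\<^sub>R (\<beta>' *\<^sub>R ?J (v t) + (2 * \<beta> t) *\<^sub>R ?J (w t))"
    using vertical_geodesic_equation[OF T x p X P geodesic w[unfolded \<eta>] v \<beta>_def] by metis
  have Jv: "((\<lambda>s. J (x s) (v s)) has_vector_derivative ?J (w t) - ?\<Gamma> (?J (v t))) (at t)"
    using J_along[OF xt v' y] by simp
  have R1: "((\<lambda>s. curvature G (x s) (w s) (v s) u) has_vector_derivative
      ?R (w' + ?\<Gamma> (w t)) (v t) u + ?R (w t) (w t) u + ?R (w t) (v t) (?\<Gamma> u)
      - ?\<Gamma> (?R (w t) (v t) u)) (at t)"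
    using curvature_along[OF xt w' v' y symmetric] by simp
  have R2: "((\<lambda>s. curvature G (x s) (v s) (J (x s) (v s)) u) has_vector_derivative
      ?R (w t) (?J (v t)) u + ?R (v t) (?J (w t)) u + ?R (v t) (?J (v t)) (?\<Gamma> u)
      - ?\<Gamma> (?R (v t) (?J (v t)) u)) (at t)"
    using curvature_along[OF xt v' Jv y symmetric] by simp
  have "((\<lambda>s. \<delta>\<^sup>2 * \<beta> s) has_real_derivative \<delta>\<^sup>2 * \<beta>') (at t)"
    using \<beta>' by (simp add: has_real_derivative_iff_has_vector_derivative has_vector_derivative_mult_right)
  from has_vector_derivative_diff[OF R1 has_vector_derivative_scaleR[OF this R2]]
  have "((\<lambda>s. E s u) has_vector_derivative
      (?R (w' + ?\<Gamma> (w t)) (v t) u + ?R (w t) (w t) u + ?R (w t) (v t) (?\<Gamma> u) - ?\<Gamma> (?R (w t) (v t) u))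
      - ((\<delta>\<^sup>2 * \<beta> t) *\<^sub>R (?R (w t) (?J (v t)) u + ?R (v t) (?J (w t)) u
          + ?R (v t) (?J (v t)) (?\<Gamma> u) - ?\<Gamma> (?R (v t) (?J (v t)) u))
        + (\<delta>\<^sup>2 * \<beta>') *\<^sub>R ?R (v t) (?J (v t)) u)) (at t)" (is "(_ has_vector_derivative ?E') _")
    by (rule has_vector_derivative_transform_within_open[OF _ T(1,2)]) (simp add: E_eq)
  moreover have "?E' + ?\<Gamma> (E t u) - E t (?\<Gamma> u) = 0"
  proof -
    have self: "?R (w t) (w t) u = 0"
      by (simp add: curvature_eq y)
    \<comment> \<open>J-invariance of the curvature and \<open>J J v = -v\<close> give R(w, Jv) =
      -R(Jw, v), and antisymmetry finishes.\<close>
    have Jw: "?R (w t) (?J (v t)) u = ?R (v t) (?J (w t)) u"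
      using curvature_J_J[OF y, of "w t" "?J (v t)" u] curvature_antisym[OF y, of "?J (w t)" "v t" u]
      by (simp add: J_J y curvature_linear_simps)
    \<comment> \<open>The coefficient 2 here matches the two terms R(w, Jv) and R(v, Jw) of the
      Leibniz rule, which \<open>Jw\<close> makes equal.\<close>
    have "?R (w' + ?\<Gamma> (w t)) (v t) u
        = (\<delta>\<^sup>2 * \<beta>') *\<^sub>R ?R (v t) (?J (v t)) u + (2 * \<delta>\<^sup>2 * \<beta> t) *\<^sub>R ?R (v t) (?J (w t)) u"
      unfolding eq using curvature_antisym[OF y, of "?J (v t)" "v t" u] curvature_antisym[OF y, of "?J (w t)" "v t" u]
      by (simp add: curvature_linear_simps linear_diff[OF curvature_linear(1)] y algebra_simps)
    then show ?thesis
      by (simp add: self Jw E_eq[OF T(2)] christoffel_linear_simps y algebra_simps flip: scaleR_2)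
  qed
  ultimately show ?thesis by blast
qed

end

section \<open>Passage to the manifold\<close>

context
  fixes M :: "'a topology" and A :: "('a, 'e::euclidean_space) chart set"
  assumes manifold: "smooth_manifold M A"
begin

lemma open_chart_img: "c \<in> A \<Longrightarrow> open (chart_img c)"
  using manifold by (simp add: smooth_manifold_def)

lemma inj_on_chart_map: "c \<in> A \<Longrightarrow> inj_on (chart_map c) (chart_dom c)"
  using manifold homeomorphic_imp_injective_map openin_subset topspace_subtopology_subset
  unfolding smooth_manifold_def by metis

lemma open_chart_map_image:
  assumes "c \<in> A" "openin M V" "V \<subseteq> chart_dom c"
  shows "open (chart_map c ` V)"
proof -
  have "openin (subtopology M (chart_dom c)) V"
    using assms by (metis openin_subtopology Int_absorb2)
  moreover have "open_map (subtopology M (chart_dom c)) (top_of_set (chart_img c)) (chart_map c)"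
    using manifold assms(1) homeomorphic_imp_open_map unfolding smooth_manifold_def by metis
  ultimately have "openin (top_of_set (chart_img c)) (chart_map c ` V)"
    unfolding open_map_def by blast
  then show ?thesis using openin_open_trans open_chart_img[OF assms(1)] by blast
qed

lemma openin_chart_dom: "c \<in> A \<Longrightarrow> openin M (chart_dom c)"
  using manifold by (simp add: smooth_manifold_def)

lemma transition_chart_map:
  "c \<in> A \<Longrightarrow> x \<in> chart_dom c \<Longrightarrow> transition c d (chart_map c x) = chart_map d x"
  by (simp add: transition_def inj_on_chart_map)

lemma differentiable_transition:
  assumes "c \<in> A" "d \<in> A" "x \<in> chart_dom c" "x \<in> chart_dom d"
  shows "transition c d differentiable (at (chart_map c x))"
  using smooth_on_differentiable manifold assms unfolding smooth_manifold_def by blast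

lemma linear_jac:
  assumes "c \<in> A" "d \<in> A" "x \<in> chart_dom c" "x \<in> chart_dom d"
  shows "linear (jac c d x)"
  unfolding jac_def using linear_dd[OF differentiable_transition[OF assms]] .

lemma jac_self:
  assumes "c \<in> A" "x \<in> chart_dom c"
  shows "jac c c x u = u"
proof -
  have "jac c c x u = dd (\<lambda>z. z) (chart_map c x) u"
    unfolding jac_def
    by (rule dd_cong[OF open_chart_img[OF assms(1)]])
       (use assms in \<open>auto simp: chart_img_def transition_chart_map\<close>)
  then show ?thesis by simp
qed

text \<open>The chain rule on the triple overlap; its image under the chart is open, so
  \<open>dd_cong\<close> can compare the transition maps there.\<close>

lemma jac_jac:
  assumes A: "c \<in> A" "d \<in> A" "e \<in> A" and x: "x \<in> chart_dom c" "x \<in> chart_dom d" "x \<in> chart_dom e"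
  shows "jac d e x (jac c d x u) = jac c e x u"
proof -
  let ?W = "chart_dom c \<inter> chart_dom d \<inter> chart_dom e"
  have W: "open (chart_map c ` ?W)"
    by (rule open_chart_map_image[OF A(1)]) (auto intro!: openin_Int openin_chart_dom A)
  have "jac c e x u = dd (transition d e \<circ> transition c d) (chart_map c x) u"
    unfolding jac_def
    by (rule dd_cong[OF W]) (use A x in \<open>auto simp: transition_chart_map\<close>)
  also have "\<dots> = jac d e x (jac c d x u)"
    using frechet_derivative_compose[of "transition c d" "chart_map c x" "transition d e"]
      differentiable_transition A x by (simp add: transition_chart_map jac_def)
  finally show ?thesis by simp
qed

text \<open>This makes the induced chart cover all of \<open>U \<times> UNIV\<close>, so
  \<open>h\<close> is a metric on a product domain and can be evaluated at arbitrary fibre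
  coordinates.\<close>

lemma chart_img_cotangent:
  assumes "c \<in> A"
  shows "chart_img (cotangent_chart A c) = chart_img c \<times> UNIV"
proof
  show "chart_img (cotangent_chart A c) \<subseteq> chart_img c \<times> UNIV"
    by (auto simp: chart_img_def cotangent_chart_def)
  show "chart_img c \<times> UNIV \<subseteq> chart_img (cotangent_chart A c)"
  proof
    fix z assume "z \<in> chart_img c \<times> (UNIV :: 'e set)"
    then obtain x q where z: "z = (chart_map c x, q)" and x: "x \<in> chart_dom c"
      by (auto simp: chart_img_def)
    \<comment> \<open>The covector with components \<open>q\<close> in the chart \<open>c\<close>,
      pulled back to every other chart by the adjoint Jacobian; the value 0 elsewhere is the default
      that \<open>cotangent_space\<close> prescribes.\<close>
    define p where "p d = (if d \<in> A \<and> x \<in> chart_dom d then adjoint (jac d c x) q else 0)" for d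
    have p: "p d \<bullet> u = q \<bullet> jac d c x u" if "d \<in> A" "x \<in> chart_dom d" for d u
      using that adjoint_works[OF linear_jac[OF that(1) assms that(2) x], of u q]
      by (simp add: p_def inner_commute)
    have "p \<in> cotangent_space A x"
      unfolding cotangent_space_def using p jac_jac assms x by (auto simp: p_def[abs_def])
    moreover have "p c = q"
      by (rule vector_eq_rdot[THEN iffD1]) (simp add: p assms x jac_self)
    ultimately show "z \<in> chart_img (cotangent_chart A c)"
      unfolding z chart_img_def cotangent_chart_def using x by force
  qed
qed

lemma metric_domain_chart:
  assumes "riemannian_metric A g" "c \<in> A"
  shows "metric_domain (chart_img c) (g c)"
  using assms open_chart_img by (intro metric_domain.intro) (auto simp: riemannian_metric_def)

lemma kaehler_domain_chart:
  assumes "kaehler_structure A J g" "c \<in> A"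
  shows "kaehler_domain (chart_img c) (g c) (J c)"
proof -
  interpret metric_domain "chart_img c" "g c"
    using metric_domain_chart assms by (auto simp: kaehler_structure_def)
  show ?thesis
    using assms by (intro kaehler_domain.intro metric_domain_axioms kaehler_domain_axioms.intro)
      (auto simp: kaehler_structure_def almost_complex_structure_def)
qed

lemma berger_domain_chart:
  assumes "kaehler_structure A J g" "berger_sasaki_metric A J g \<delta> h" "c \<in> A"
  shows "berger_domain (chart_img c) (g c) (J c) (h (cotangent_chart A c)) \<delta>"
proof -
  interpret kaehler_domain "chart_img c" "g c" "J c"
    using kaehler_domain_chart assms by blast
  have h: "riemannian_metric (cotangent_atlas A) h" "cotangent_chart A c \<in> cotangent_atlas A"
    using assms by (auto simp: berger_sasaki_metric_def cotangent_atlas_def)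
  have "open (chart_img (cotangent_chart A c))"
    using open_domain by (simp add: chart_img_cotangent assms(3) open_Times)
  then have "metric_domain (chart_img (cotangent_chart A c)) (h (cotangent_chart A c))"
    using h by (intro metric_domain.intro) (auto simp: riemannian_metric_def)
  then interpret H: metric_domain "chart_img c \<times> UNIV" "h (cotangent_chart A c)"
    by (simp only: chart_img_cotangent[OF assms(3)])
  show ?thesis
    using assms(2,3) by unfold_locales (auto simp: berger_sasaki_metric_def Let_def)
qed

end

lemma smooth_on_vector_derivative:
  fixes z :: "real \<Rightarrow> 'b::real_normed_vector"
  assumes "open T" "smooth_on T z" "t \<in> T"
  shows "(z has_vector_derivative vector_derivative z (at t)) (at t)"
    and "((\<lambda>s. vector_derivative z (at s)) has_vector_derivative
      vector_derivative (\<lambda>s. vector_derivative z (at s)) (at t)) (at t)"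
proof -
  show "(z has_vector_derivative vector_derivative z (at t)) (at t)"
    using smooth_on_differentiable[OF assms(2,3)] vector_derivative_works by blast
  have eq: "dd z s 1 = vector_derivative z (at s)" if "s \<in> T" for s
    using frechet_derivative_eq_vector_derivative[OF smooth_on_differentiable[OF assms(2) that]] by simp
  have "(\<lambda>s. vector_derivative z (at s)) differentiable (at t)"
    using has_derivative_transform_within_open[OF
        has_derivative_dd[OF smooth_on_differentiable[OF smooth_on_dd[OF assms(2)] assms(3)]] assms(1,3) eq]
    by (rule differentiableI)
  then show "((\<lambda>s. vector_derivative z (at s)) has_vector_derivative
      vector_derivative (\<lambda>s. vector_derivative z (at s)) (at t)) (at t)"
    using vector_derivative_works by blast
qed

theorem theorem5p8:
  fixes M :: "'a topology"
    and A :: "('a, 'e::euclidean_space) chart set"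
    and m :: nat
    and J :: "('a, 'e) chart \<Rightarrow> 'e \<Rightarrow> 'e \<Rightarrow> 'e"
    and g :: "('a, 'e) chart \<Rightarrow> 'e \<Rightarrow> 'e \<Rightarrow> 'e \<Rightarrow> real"
    and \<delta> :: real
    and h :: "('a \<times> (('a, 'e) chart \<Rightarrow> 'e), 'e \<times> 'e) chart
                \<Rightarrow> 'e \<times> 'e \<Rightarrow> 'e \<times> 'e \<Rightarrow> 'e \<times> 'e \<Rightarrow> real"
    and I :: "real set"
    and \<gamma> :: "real \<Rightarrow> 'a"
    and \<theta> :: "real \<Rightarrow> ('a, 'e) chart \<Rightarrow> 'e"
  assumes "smooth_manifold M A" and "DIM('e) = 2 * m"
    and "kaehler_structure A J g"
    and "locally_symmetric A g"
    and "berger_sasaki_metric A J g \<delta> h"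
    and "open I" and "is_interval I"
    and "geodesic (cotangent_atlas A) h I (\<lambda>t. (\<gamma> t, \<theta> t))"
  shows "parallel_endo_along A g I \<gamma> (berger_curvature_along J g \<delta> \<gamma> \<theta>)"
  unfolding parallel_endo_along_def Let_def
proof (intro ballI impI allI)
  fix c t u assume c: "c \<in> A" and t: "t \<in> I" and dom: "\<gamma> t \<in> chart_dom c"
  interpret berger_domain "chart_img c" "g c" "J c" "h (cotangent_chart A c)" \<delta>
    using berger_domain_chart assms c by blast
  let ?C = "\<lambda>t. (\<gamma> t, \<theta> t)" and ?c = "cotangent_chart A c"
  have ca: "?c \<in> cotangent_atlas A" using c by (simp add: cotangent_atlas_def)
  have smooth: "smooth_curve (cotangent_atlas A) I ?C" using assms(8) by (simp add: geodesic_def)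
  \<comment> \<open>The curve lies in some induced chart, which gives the compatibility of the
    components of \<open>\<theta> t\<close>; membership in the induced chart of the given
    \<open>c\<close> follows.\<close>
  have "\<theta> t \<in> cotangent_space A (\<gamma> t)"
    using smooth t unfolding smooth_curve_def cotangent_atlas_def cotangent_chart_def by auto
  then have domc: "?C t \<in> chart_dom ?c" using dom by (simp add: cotangent_chart_def)
  then obtain T where T: "open T" "t \<in> T" "?C ` T \<subseteq> chart_dom ?c" "smooth_on T (chart_map ?c \<circ> ?C)"
    using smooth ca t unfolding smooth_curve_def by blast
  define x p where "x s = chart_map c (\<gamma> s)" and "p s = \<theta> s c" for s
  define X P where "X = velocity c \<gamma>" and "P s = vector_derivative p (at s)" for s
  have z: "chart_map ?c \<circ> ?C = (\<lambda>s. (x s, p s))"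
    by (auto simp: cotangent_chart_def x_def p_def)
  have xX: "X s = vector_derivative x (at s)" for s
    by (simp add: X_def velocity_def x_def[abs_def] comp_def)
  have sx: "smooth_on T x" and sp: "smooth_on T p"
    using smooth_on_bounded_linear[OF T(1) bounded_linear_fst T(4)[unfolded z]]
      smooth_on_bounded_linear[OF T(1) bounded_linear_snd T(4)[unfolded z]] by simp_all
  have x: "(x has_vector_derivative X s) (at s)" if "s \<in> T" for s
    unfolding xX using smooth_on_vector_derivative(1)[OF T(1) sx that] .
  have p: "(p has_vector_derivative P s) (at s)" if "s \<in> T" for s
    unfolding P_def using smooth_on_vector_derivative(1)[OF T(1) sp that] .
  obtain X' where X': "(X has_vector_derivative X') (at t)"
    using smooth_on_vector_derivative(2)[OF T(1) sx T(2)] unfolding xX[symmetric] by blast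
  obtain P' where P': "(P has_vector_derivative P') (at t)"
    using smooth_on_vector_derivative(2)[OF T(1) sp T(2)] unfolding P_def[symmetric] by blast
  have velocity: "velocity ?c ?C s = (X s, P s)" if "s \<in> T" for s
    unfolding velocity_def z
    by (rule vector_derivative_at) (intro has_vector_derivative_Pair x p that)
  \<comment> \<open>The velocity is identified with \<open>(X s, P s)\<close> on all of
    \<open>T\<close>, a neighbourhood of \<open>t\<close>, so it can be differentiated
    again.\<close>
  have "(velocity ?c ?C has_vector_derivative (X', P')) (at t)"
    by (rule has_vector_derivative_transform_within_open[OF has_vector_derivative_Pair[OF X' P'] T(1,2)])
       (simp add: velocity)
  moreover have "vector_derivative (velocity ?c ?C) (at t)
      + christoffel (h ?c) ((chart_map ?c \<circ> ?C) t) (velocity ?c ?C t) (velocity ?c ?C t) = 0"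
    using assms(8) ca t domc unfolding geodesic_def comp_def by blast
  ultimately have geo: "(X', P') + christoffel (h ?c) (x t, p t) (X t, P t) (X t, P t) = 0"
    by (simp add: vector_derivative_at z velocity[OF T(2)])
  have img: "x s \<in> chart_img c" if "s \<in> T" for s
    using T(3) that by (auto simp: x_def chart_img_def cotangent_chart_def)
  have sym: "nabla_curvature (g c) (x t) z a b d = 0" for z a b d
    using assms(4) c img[OF T(2)] by (simp add: locally_symmetric_def)
  have "\<exists>E'. ((\<lambda>s. berger_curvature_along J g \<delta> \<gamma> \<theta> s c u) has_vector_derivative E') (at t) \<and>
    E' + christoffel (g c) (x t) (X t) (berger_curvature_along J g \<delta> \<gamma> \<theta> t c u)
      - berger_curvature_along J g \<delta> \<gamma> \<theta> t c (christoffel (g c) (x t) (X t) u) = 0"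
    by (rule berger_curvature_parallel[OF T(1,2) img x p X' P' geo sym refl refl refl])
       (simp_all add: berger_curvature_along_def covec_deriv_def christoffel_form_def Let_def
          x_def p_def[abs_def] X_def P_def fun_eq_iff)
  then show "\<exists>E'. ((\<lambda>s. berger_curvature_along J g \<delta> \<gamma> \<theta> s c u) has_vector_derivative E') (at t) \<and>
    E' + christoffel (g c) (chart_map c (\<gamma> t)) (velocity c \<gamma> t) (berger_curvature_along J g \<delta> \<gamma> \<theta> t c u)
      - berger_curvature_along J g \<delta> \<gamma> \<theta> t c (christoffel (g c) (chart_map c (\<gamma> t)) (velocity c \<gamma> t) u) = 0"
    by (simp add: x_def X_def)
qed

end
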